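(* Let $\mathfrak{n}$ be an $r$-step Anosov Lie algebra of type $(n_1,\dots,n_r)$. (1) If $n_1=3$, then $n_i$ is a multiple of $3$ for all $i=2,\dots,r$. (2) If $n_1=4$, then $n_i$ is even for all $i=2,\dots,r$. (3) If $n_1$ is prime, the associated polynomial $p_1$ is irreducible over $\mathbb{Q}$, and $r<n_1$, then $n_1$ divides $n_i$ for all $i=2,\dots,r$.
   Context: A finite-dimensional real nilpotent Lie algebra $\mathfrak{n}$ is Anosov if it has a basis with rational structure constants and an automorphism with no eigenvalue of modulus one (an Anosov automorphism) represented in that basis by an integer matrix of determinant $\pm1$. With $\mathfrak{n}^0=\mathfrak{n}$, $\mathfrak{n}^i=[\mathfrak{n},\mathfrak{n}^{i-1}]$, an $r$-step nilpotent $\mathfrak{n}$ has type $(n_1,\dots,n_r)$ with $n_i=\dim(\mathfrak{n}^{i-1}/\mathfrak{n}^i)$. Standing assumption: $n_1\ge3$ and $r\ge2$. Associated polynomial: let $n=n_1$ and let $\mathfrak{f}_{n,r}$ be the free $r$-step nilpotent real Lie algebra on $n$ generators, $V_1$ the span of a generating set $\mathcal{B}_1$ of cardinality $n$. For $A\in GL_n(\mathbb{Z})$ let $f^A$ be the automorphism of $\mathfrak{f}_{n,r}$ acting on $V_1$ by $A$ in the basis $\mathcal{B}_1$. A semisimple Anosov automorphism of $\mathfrak{n}$ (which always exists) is induced by $f^A$ on $\mathfrak{n}\cong\mathfrak{f}_{n,r}/\mathfrak{i}$ for a semisimple $A\in GL_n(\mathbb{Z})$ without eigenvalues of modulus one and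 an ideal $\mathfrak{i}\subset[\mathfrak{f}_{n,r},\mathfrak{f}_{n,r}]$ that is $f^A$-invariant, on which $f^A$ is unimodular, that has a basis of $\mathbb{Z}$-linear combinations of elements of the Hall basis determined by $\mathcal{B}_1$, and that contains all eigenspaces of $f^A$ for eigenvalues of modulus one. The associated polynomial $p_1$ is the characteristic polynomial of $A$. *)

theory Defs
  imports Complex_Main "Jordan_Normal_Form.Char_Poly"
begin

section \<open>Real Lie algebras\<close>

definition lie_algebra :: "('a::real_vector \<Rightarrow> 'a \<Rightarrow> 'a) \<Rightarrow> bool" where
  "lie_algebra br \<longleftrightarrow>
     (\<forall>x. linear (br x)) \<and> (\<forall>y. linear (\<lambda>x. br x y)) \<and>
     (\<forall>x. br x x = 0) \<and>
     (\<forall>x y z. br x (br y z) + br y (br z x) + br z (br x y) = 0)"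

definition lie_hom ::
  "('a::real_vector \<Rightarrow> 'a \<Rightarrow> 'a) \<Rightarrow> ('b::real_vector \<Rightarrow> 'b \<Rightarrow> 'b) \<Rightarrow> ('a \<Rightarrow> 'b) \<Rightarrow> bool" where
  "lie_hom br br' f \<longleftrightarrow> linear f \<and> (\<forall>x y. f (br x y) = br' (f x) (f y))"

definition lie_automorphism :: "('a::real_vector \<Rightarrow> 'a \<Rightarrow> 'a) \<Rightarrow> ('a \<Rightarrow> 'a) \<Rightarrow> bool" where
  "lie_automorphism br f \<longleftrightarrow> lie_hom br br f \<and> bij f"

definition lie_ideal :: "('a::real_vector \<Rightarrow> 'a \<Rightarrow> 'a) \<Rightarrow> 'a set \<Rightarrow> bool" where
  "lie_ideal br I \<longleftrightarrow> subspace I \<and> (\<forall>x. \<forall>y\<in>I. br x y \<in> I)"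

primrec lower_central :: "('a::real_vector \<Rightarrow> 'a \<Rightarrow> 'a) \<Rightarrow> nat \<Rightarrow> 'a set" where
  "lower_central br 0 = UNIV"
| "lower_central br (Suc i) = span {br x y | x y. y \<in> lower_central br i}"

definition nilpotent_of_step :: "('a::real_vector \<Rightarrow> 'a \<Rightarrow> 'a) \<Rightarrow> nat \<Rightarrow> bool" where
  "nilpotent_of_step br r \<longleftrightarrow>
     lower_central br r = {0} \<and> (\<forall>j<r. lower_central br j \<noteq> {0})"

text \<open>The type \<open>(n 1, \<dots>, n r)\<close> of an \<open>r\<close>-step nilpotent Lie algebra. The dimension of a
  quotient of nested subspaces is written as a difference of dimensions; this is only
  used for finite-dimensional algebras.\<close>

definition has_type :: "('a::real_vector \<Rightarrow> 'a \<Rightarrow> 'a) \<Rightarrow> nat \<Rightarrow> (nat \<Rightarrow> nat) \<Rightarrow> bool" where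
  "has_type br r n \<longleftrightarrow> nilpotent_of_step br r \<and>
     (\<forall>i\<in>{1..r}. n i = dim (lower_central br (i - 1)) - dim (lower_central br i))"


section \<open>Linear maps, bases and matrices\<close>

definition ordered_basis :: "(nat \<Rightarrow> 'a::real_vector) \<Rightarrow> nat \<Rightarrow> 'a set \<Rightarrow> bool" where
  "ordered_basis e d W \<longleftrightarrow>
     inj_on e {..<d} \<and> independent (e ` {..<d}) \<and> span (e ` {..<d}) = W"

definition matrix_of_map ::
  "('a::real_vector \<Rightarrow> 'a) \<Rightarrow> (nat \<Rightarrow> 'a) \<Rightarrow> nat \<Rightarrow> real mat \<Rightarrow> bool" where
  "matrix_of_map f e d M \<longleftrightarrow> M \<in> carrier_mat d d \<and>
     (\<forall>j<d. f (e j) = (\<Sum>i<d. M $$ (i, j) *\<^sub>R e i))"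

text \<open>The vector \<open>x + \<i> y\<close> of the complexification satisfies
  \<open>f (x + \<i> y) = \<lambda> (x + \<i> y)\<close>; both sides are split into real and imaginary parts.\<close>

definition in_complex_eigenspace ::
  "('a::real_vector \<Rightarrow> 'a) \<Rightarrow> complex \<Rightarrow> 'a \<Rightarrow> 'a \<Rightarrow> bool" where
  "in_complex_eigenspace f l x y \<longleftrightarrow>
     f x = Re l *\<^sub>R x - Im l *\<^sub>R y \<and> f y = Im l *\<^sub>R x + Re l *\<^sub>R y"

definition complex_eigenvalue :: "('a::real_vector \<Rightarrow> 'a) \<Rightarrow> complex \<Rightarrow> bool" where
  "complex_eigenvalue f l \<longleftrightarrow> (\<exists>x y. (x, y) \<noteq> (0, 0) \<and> in_complex_eigenspace f l x y)"

text \<open>Semisimple means diagonalizable over the complex numbers.\<close>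

definition semisimple_mat :: "complex mat \<Rightarrow> bool" where
  "semisimple_mat M \<longleftrightarrow> (\<exists>D. diagonal_mat D \<and> similar_mat M D)"

definition semisimple_map :: "('a::real_vector \<Rightarrow> 'a) \<Rightarrow> bool" where
  "semisimple_map f \<longleftrightarrow>
     (\<exists>e d M. ordered_basis e d UNIV \<and> matrix_of_map f e d M \<and>
        semisimple_mat (map_mat complex_of_real M))"

definition unimodular_on :: "('a::real_vector \<Rightarrow> 'a) \<Rightarrow> 'a set \<Rightarrow> bool" where
  "unimodular_on f W \<longleftrightarrow>
     (\<exists>e d M. ordered_basis e d W \<and> matrix_of_map f e d M \<and> \<bar>det M\<bar> = 1)"


section \<open>Anosov Lie algebras\<close>

definition rational_structure_constants ::
  "('a::real_vector \<Rightarrow> 'a \<Rightarrow> 'a) \<Rightarrow> (nat \<Rightarrow> 'a) \<Rightarrow> nat \<Rightarrow> bool" where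
  "rational_structure_constants br e d \<longleftrightarrow>
     (\<forall>i<d. \<forall>j<d. \<exists>c. (\<forall>k<d. c k \<in> \<rat>) \<and> br (e i) (e j) = (\<Sum>k<d. c k *\<^sub>R e k))"

definition anosov_automorphism ::
  "('a::real_vector \<Rightarrow> 'a \<Rightarrow> 'a) \<Rightarrow> ('a \<Rightarrow> 'a) \<Rightarrow> bool" where
  "anosov_automorphism br T \<longleftrightarrow>
     lie_automorphism br T \<and>
     (\<forall>l. complex_eigenvalue T l \<longrightarrow> cmod l \<noteq> 1) \<and>
     (\<exists>e d (M :: int mat).
        ordered_basis e d UNIV \<and> rational_structure_constants br e d \<and>
        matrix_of_map T e d (map_mat real_of_int M) \<and> det M \<in> {1, -1})"

definition anosov_lie_algebra :: "('a::real_vector \<Rightarrow> 'a \<Rightarrow> 'a) \<Rightarrow> bool" where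
  "anosov_lie_algebra br \<longleftrightarrow>
     lie_algebra br \<and> (\<exists>B :: 'a set. finite B \<and> span B = UNIV) \<and>
     (\<exists>r. nilpotent_of_step br r) \<and> (\<exists>T. anosov_automorphism br T)"


section \<open>Free nilpotent Lie algebras\<close>

datatype lword = Gen nat | Br lword lword

primrec degree_of :: "lword \<Rightarrow> nat" where
  "degree_of (Gen i) = 1"
| "degree_of (Br u v) = degree_of u + degree_of v"

primrec letters :: "lword \<Rightarrow> nat set" where
  "letters (Gen i) = {i}"
| "letters (Br u v) = letters u \<union> letters v"

primrec eval_word :: "('f::real_vector \<Rightarrow> 'f \<Rightarrow> 'f) \<Rightarrow> (nat \<Rightarrow> 'f) \<Rightarrow> lword \<Rightarrow> 'f" where
  "eval_word br b (Gen i) = b i"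
| "eval_word br b (Br u v) = br (eval_word br b u) (eval_word br b v)"

text \<open>The free nonassociative real algebra on the letters \<open>0, \<dots>, n - 1\<close>: finitely
  supported functions on bracket words, with addition and scalar multiplication
  pointwise. A word \<open>Br u v\<close> arises as a product of words in exactly one way, so the
  convolution product has the closed form below.\<close>

definition magma_algebra :: "nat \<Rightarrow> (lword \<Rightarrow> real) set" where
  "magma_algebra n = {p. finite {w. p w \<noteq> 0} \<and> (\<forall>w. p w \<noteq> 0 \<longrightarrow> letters w \<subseteq> {..<n})}"

definition mult :: "(lword \<Rightarrow> real) \<Rightarrow> (lword \<Rightarrow> real) \<Rightarrow> lword \<Rightarrow> real" where
  "mult p q w = (case w of Gen i \<Rightarrow> 0 | Br u v \<Rightarrow> p u * q v)"

definition eval ::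
  "('f::real_vector \<Rightarrow> 'f \<Rightarrow> 'f) \<Rightarrow> (nat \<Rightarrow> 'f) \<Rightarrow> (lword \<Rightarrow> real) \<Rightarrow> 'f" where
  "eval br b p = (\<Sum>w | p w \<noteq> 0. p w *\<^sub>R eval_word br b w)"

text \<open>The two-sided ideal generated by the squares, the Jacobi expressions and all words
  of degree greater than \<open>r\<close>. The quotient of the algebra above by this ideal is the
  free \<open>r\<close>-step nilpotent Lie algebra on \<open>n\<close> generators.\<close>

inductive_set nilpotent_relations :: "nat \<Rightarrow> nat \<Rightarrow> (lword \<Rightarrow> real) set" for n r where
  zero: "(\<lambda>w. 0) \<in> nilpotent_relations n r"
| add: "p \<in> nilpotent_relations n r \<Longrightarrow> q \<in> nilpotent_relations n r \<Longrightarrow>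
    (\<lambda>w. p w + q w) \<in> nilpotent_relations n r"
| scale: "p \<in> nilpotent_relations n r \<Longrightarrow> (\<lambda>w. c * p w) \<in> nilpotent_relations n r"
| left: "p \<in> magma_algebra n \<Longrightarrow> q \<in> nilpotent_relations n r \<Longrightarrow>
    mult p q \<in> nilpotent_relations n r"
| right: "p \<in> nilpotent_relations n r \<Longrightarrow> q \<in> magma_algebra n \<Longrightarrow>
    mult p q \<in> nilpotent_relations n r"
| square: "p \<in> magma_algebra n \<Longrightarrow> mult p p \<in> nilpotent_relations n r"
| jacobi: "p \<in> magma_algebra n \<Longrightarrow> q \<in> magma_algebra n \<Longrightarrow> s \<in> magma_algebra n \<Longrightarrow>
    (\<lambda>w. mult p (mult q s) w + mult q (mult s p) w + mult s (mult p q) w)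
      \<in> nilpotent_relations n r"
| high_degree: "letters u \<subseteq> {..<n} \<Longrightarrow> degree_of u > r \<Longrightarrow>
    (\<lambda>w. if w = u then 1 else 0) \<in> nilpotent_relations n r"

text \<open>\<open>br\<close> makes the type \<open>'f\<close> a free \<open>r\<close>-step nilpotent Lie algebra with free
  generating set \<open>b 0, \<dots>, b (n - 1)\<close>, i.e. evaluation identifies \<open>'f\<close> with the quotient
  described above. Such algebras are unique up to a unique isomorphism matching the
  generators.\<close>

definition free_nilpotent_lie_algebra ::
  "nat \<Rightarrow> nat \<Rightarrow> ('f::real_vector \<Rightarrow> 'f \<Rightarrow> 'f) \<Rightarrow> (nat \<Rightarrow> 'f) \<Rightarrow> bool" where
  "free_nilpotent_lie_algebra n r br b \<longleftrightarrow>
     lie_algebra br \<and>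
     eval br b ` magma_algebra n = UNIV \<and>
     (\<forall>p\<in>magma_algebra n. eval br b p = 0 \<longleftrightarrow> p \<in> nilpotent_relations n r)"


section \<open>Hall bases\<close>

text \<open>Hall words for the ordering by degree, where words of equal degree greater than one
  are compared lexicographically by their left and right factors.\<close>

fun word_less :: "lword \<Rightarrow> lword \<Rightarrow> bool" where
  "word_less (Gen i) (Gen j) \<longleftrightarrow> i < j"
| "word_less (Gen i) (Br u v) \<longleftrightarrow> True"
| "word_less (Br u v) (Gen j) \<longleftrightarrow> False"
| "word_less (Br u v) (Br u' v') \<longleftrightarrow>
     degree_of (Br u v) < degree_of (Br u' v') \<or>
     degree_of (Br u v) = degree_of (Br u' v') \<and>
       (word_less u u' \<or> u = u' \<and> word_less v v')"

primrec hall_word :: "lword \<Rightarrow> bool" where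
  "hall_word (Gen i) \<longleftrightarrow> True"
| "hall_word (Br u v) \<longleftrightarrow> hall_word u \<and> hall_word v \<and> word_less v u \<and>
     (case u of Gen i \<Rightarrow> True | Br x y \<Rightarrow> \<not> word_less v y)"

definition hall_words :: "nat \<Rightarrow> nat \<Rightarrow> lword set" where
  "hall_words n r = {w. hall_word w \<and> letters w \<subseteq> {..<n} \<and> degree_of w \<le> r}"

definition hall_integer_span ::
  "nat \<Rightarrow> nat \<Rightarrow> ('f::real_vector \<Rightarrow> 'f \<Rightarrow> 'f) \<Rightarrow> (nat \<Rightarrow> 'f) \<Rightarrow> 'f set" where
  "hall_integer_span n r br b =
     {(\<Sum>w\<in>hall_words n r. real_of_int (c w) *\<^sub>R eval_word br b w) | c :: lword \<Rightarrow> int. True}"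


section \<open>The associated polynomial\<close>

text \<open>\<open>brF\<close>, \<open>b\<close> is the free \<open>r\<close>-step nilpotent Lie algebra on \<open>n\<close> generators, \<open>fA\<close> its
  automorphism determined by \<open>A\<close>, and \<open>\<phi>\<close> identifies the quotient of it by \<open>I\<close> with the Lie
  algebra \<open>br\<close>, whose semisimple Anosov automorphism \<open>T\<close> is the one induced by \<open>fA\<close>.\<close>

definition associated_polynomial ::
  "nat \<Rightarrow> nat \<Rightarrow> ('f::real_vector \<Rightarrow> 'f \<Rightarrow> 'f) \<Rightarrow> (nat \<Rightarrow> 'f) \<Rightarrow>
   ('a::real_vector \<Rightarrow> 'a \<Rightarrow> 'a) \<Rightarrow> int poly \<Rightarrow> bool" where
  "associated_polynomial n r brF b br p \<longleftrightarrow>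
     free_nilpotent_lie_algebra n r brF b \<and>
     (\<exists>(A :: int mat) fA I \<phi> T.
        A \<in> carrier_mat n n \<and> det A \<in> {1, -1} \<and>
        semisimple_mat (map_mat of_int A) \<and>
        (\<forall>l. eigenvalue (map_mat of_int A) l \<longrightarrow> cmod l \<noteq> 1) \<and>
        lie_automorphism brF fA \<and>
        (\<forall>j<n. fA (b j) = (\<Sum>i<n. real_of_int (A $$ (i, j)) *\<^sub>R b i)) \<and>
        lie_ideal brF I \<and> I \<subseteq> lower_central brF 1 \<and>
        fA ` I \<subseteq> I \<and> unimodular_on fA I \<and>
        (\<exists>B. B \<subseteq> hall_integer_span n r brF b \<and> independent B \<and> span B = I) \<and>
        (\<forall>l x y. cmod l = 1 \<and> in_complex_eigenspace fA l x y \<longrightarrow> x \<in> I \<and> y \<in> I) \<and>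
        lie_hom brF br \<phi> \<and> surj \<phi> \<and> {x. \<phi> x = 0} = I \<and>
        anosov_automorphism br T \<and> semisimple_map T \<and> (\<forall>x. T (\<phi> x) = \<phi> (fA x)) \<and>
        p = char_poly A)"

end

(*
  Let T be an Anosov automorphism and P the characteristic polynomial of T on the abelianization.
  An eigenvalue l of T on the quotient of consecutive terms of the lower central series, dual to
  an invariant functional, is a product of roots of P: pull the functional back along the bracket.
  Suppose that all irreducible factors of P have degree a power of a prime m, but that the degree
  of l is not divisible by m. These factors then stay irreducible over the field of l, so averaging
  the factorization of l over conjugates writes a power of l as a product of norms of roots of P,
  which are 1 or -1. Hence l has modulus one, which is excluded. So m divides the degrees of all
  eigenvalues, and with them the dimension of each quotient. Instead of Galois groups, the
  averaging counts multiplicities in finite families of numbers with rational power sums.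
*)

theory Submission
  imports Defs "Berlekamp_Zassenhaus.Factor_Bound"
    "HOL-Computational_Algebra.Polynomial_FPS"
begin

text \<open>Rational power sums multiply when families are multiplied, and Newton's identities turn
  them back into a rational polynomial, in which conjugate numbers occur equally often. Nothing more
  is asked of a Galois group. The prime powers come from hyperbolicity. A linear irreducible factor
  would have a single root, of modulus one, so neither degree 1 nor codegree 1 occurs. For
  \<open>n 1 = 3\<close> this leaves degree 3, for \<open>n 1 = 4\<close> degrees 2 and 4; in the
  third claim the polynomial is irreducible of prime degree. On the quotients the matrices are
  merely rational. Integrality is taken from the whole algebra: each irreducible factor of the
  polynomial on the abelianization divides the integral \<open>char_poly M\<close>, whose constant
  term is a unit, and this fixes its norm. Eigenvalues on quotients are carried by complex-valued
  functionals, on which complex polynomials act although the algebra is real.\<close>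

hide_const (open) up_ring.coeff up_ring.monom module.smult Coset.order Missing_List.span

declare pCons_one [simp del]

abbreviation cpoly :: "rat poly \<Rightarrow> complex poly" where
  "cpoly \<equiv> map_poly of_rat"

interpretation cpoly_hom: map_poly_inj_idom_hom "of_rat :: rat \<Rightarrow> complex" ..

section \<open>Families of numbers with rational power sums\<close>

text \<open>Equivalently, the multiset of values is Galois invariant. The index set allows values to
  repeat.\<close>

definition rational_family :: "'i set \<Rightarrow> ('i \<Rightarrow> complex) \<Rightarrow> bool" where
  "rational_family I v \<longleftrightarrow> finite I \<and> (\<forall>k. (\<Sum>i\<in>I. v i ^ k) \<in> \<rat>)"

text \<open>This is the logarithmic derivative with denominators cleared: the factor
  \<open>1 - v X\<close> contributes \<open>- v / (1 - v X)\<close>, a geometric series whose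
  coefficients add up to power sums.\<close>

lemma fps_deriv_prod_linear:
  fixes v :: "'i \<Rightarrow> complex"
  assumes "finite I"
  shows "fps_deriv (fps_of_poly (\<Prod>i\<in>I. [:1, - v i:])) =
    - Abs_fps (\<lambda>k. \<Sum>i\<in>I. v i ^ Suc k) * fps_of_poly (\<Prod>i\<in>I. [:1, - v i:])"
  using assms
proof (induction I rule: finite_induct)
  case empty
  have "Abs_fps (\<lambda>k. 0::complex) = 0" by (simp add: fps_eq_iff)
  then show ?case by simp
next
  case (insert x I)
  let ?L = "fps_of_poly [:1, - v x:]" and ?Q = "fps_of_poly (\<Prod>i\<in>I. [:1, - v i:])"
  let ?G = "Abs_fps (\<lambda>k. \<Sum>i\<in>I. v i ^ Suc k)" and ?H = "Abs_fps (\<lambda>k. v x ^ Suc k)"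
  have L: "?L = 1 - fps_const (v x) * fps_X"
    by (simp add: fps_of_poly_pCons fps_of_poly_const algebra_simps)
  have 1: "fps_deriv ?L = - ?H * ?L"
  proof (rule fps_ext)
    fix k
    show "fps_nth (fps_deriv ?L) k = fps_nth (- ?H * ?L) k"
      unfolding L by (cases k) (simp_all add: algebra_simps fps_X_mult_nth mult_delta_left)
  qed
  have 2: "Abs_fps (\<lambda>k. \<Sum>i\<in>insert x I. v i ^ Suc k) = ?G + ?H"
    using insert by (simp add: fps_eq_iff)
  have 3: "fps_of_poly (\<Prod>i\<in>insert x I. [:1, - v i:]) = ?L * ?Q"
    by (simp only: prod.insert[OF insert.hyps(1,2)] fps_of_poly_mult)
  have "l * (- g * q) + - h * l * q = - (g + h) * (l * q)" for l g q h :: "complex fps"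
    by (simp add: algebra_simps)
  then show ?case
    unfolding 2 3 fps_deriv_mult 1 insert.IH .
qed

text \<open>Newton's identities: comparing coefficients in the logarithmic derivative expresses
  elementary symmetric functions and power sums through each other.\<close>

lemma rational_family_iff:
  assumes "finite I"
  shows "rational_family I v \<longleftrightarrow> (\<forall>k. coeff (\<Prod>i\<in>I. [:1, - v i:]) k \<in> \<rat>)"
proof -
  define q where "q = coeff (\<Prod>i\<in>I. [:1, - v i:])"
  define s where "s k = (\<Sum>i\<in>I. v i ^ Suc k)" for k
  have q0: "q 0 = 1"
    by (simp add: q_def poly_prod flip: poly_0_coeff_0)
  have newton: "of_nat (Suc k) * q (Suc k) = - (\<Sum>j\<le>k. s j * q (k - j))" for k
  proof -
    have "fps_nth (fps_deriv (fps_of_poly (\<Prod>i\<in>I. [:1, - v i:]))) k =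
        fps_nth (- Abs_fps (\<lambda>k. \<Sum>i\<in>I. v i ^ Suc k) * fps_of_poly (\<Prod>i\<in>I. [:1, - v i:])) k"
      using fps_deriv_prod_linear[OF assms, of v] by simp
    then show ?thesis
      unfolding fps_deriv_nth fps_mult_nth
      by (simp add: q_def s_def atLeast0AtMost sum_negf)
  qed
  have "rational_family I v \<longleftrightarrow> (\<forall>k. s k \<in> \<rat>)"
  proof
    assume "rational_family I v"
    then show "\<forall>k. s k \<in> \<rat>" by (simp add: rational_family_def s_def del: power_Suc)
  next
    assume s: "\<forall>k. s k \<in> \<rat>"
    have "(\<Sum>i\<in>I. v i ^ k) \<in> \<rat>" for k
      using s by (cases k) (auto simp: s_def)
    with assms show "rational_family I v" by (simp add: rational_family_def)
  qed
  also have "\<dots> \<longleftrightarrow> (\<forall>k. q k \<in> \<rat>)"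
  proof
    assume s: "\<forall>k. s k \<in> \<rat>"
    have "q k \<in> \<rat>" for k
    proof (induction k rule: less_induct)
      case (less k)
      show ?case
      proof (cases k)
        case 0
        then show ?thesis by (simp add: q0)
      next
        case (Suc l)
        have "q k = - (\<Sum>j\<le>l. s j * q (l - j)) / of_nat (Suc l)"
          using newton[of l] unfolding Suc by (simp add: field_simps del: of_nat_Suc)
        moreover have "(\<Sum>j\<le>l. s j * q (l - j)) \<in> \<rat>"
          by (intro Rats_sum Rats_mult) (use s less Suc in auto)
        ultimately show ?thesis by simp
      qed
    qed
    then show "\<forall>k. q k \<in> \<rat>" ..
  next
    assume q: "\<forall>k. q k \<in> \<rat>"
    have "s k \<in> \<rat>" for k
    proof (induction k rule: less_induct)
      case (less k)
      \<comment> \<open>The last term carries the coefficient \<open>q 0 = 1\<close>, so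
        \<open>s k\<close> can be isolated.\<close>
      have "(\<Sum>j\<le>k. s j * q (k - j)) = (\<Sum>j<k. s j * q (k - j)) + s k"
        by (simp add: q0 flip: lessThan_Suc_atMost)
      then have "s k = - of_nat (Suc k) * q (Suc k) - (\<Sum>j<k. s j * q (k - j))"
        using newton[of k] by (simp del: of_nat_Suc)
      moreover have "(\<Sum>j<k. s j * q (k - j)) \<in> \<rat>"
        by (intro Rats_sum Rats_mult) (use q less in auto)
      ultimately show ?case using q by (metis Rats_diff Rats_minus_iff Rats_mult Rats_of_nat)
    qed
    then show "\<forall>k. s k \<in> \<rat>" ..
  qed
  finally show ?thesis by (simp add: q_def)
qed

text \<open>For \<open>z = 0\<close> both sides are 1. The way back cannot recover a root 0, hence
  the condition \<open>z \<noteq> 0\<close> there and nonzero values in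
  \<open>rational_familyD\<close>.\<close>

lemma reflect_poly_linear: "reflect_poly [:- z, 1:] = [:1, - z::complex:]"
  by (cases "z = 0") (simp_all add: reflect_poly_pCons reflect_poly_pCons')

lemma reflect_poly_linear': "z \<noteq> 0 \<Longrightarrow> reflect_poly [:1, - z:] = [:- z, 1::complex:]"
  by (simp add: reflect_poly_pCons)

lemma coeff_reflect_poly_Rats:
  assumes "\<And>k. coeff p k \<in> (\<rat> :: complex set)"
  shows "coeff (reflect_poly p) k \<in> \<rat>"
  using assms by (simp add: coeff_reflect_poly)

lemma rational_familyI:
  assumes "finite I" "\<And>k. coeff (\<Prod>i\<in>I. [:- v i, 1:]) k \<in> \<rat>"
  shows "rational_family I v"
proof -
  have "reflect_poly (\<Prod>i\<in>I. [:- v i, 1:]) = (\<Prod>i\<in>I. [:1, - v i:])"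
    by (simp add: reflect_poly_prod reflect_poly_linear)
  then show ?thesis
    using assms coeff_reflect_poly_Rats rational_family_iff by metis
qed

lemma rational_familyD:
  assumes "rational_family I v" "\<And>i. i \<in> I \<Longrightarrow> v i \<noteq> 0"
  shows "coeff (\<Prod>i\<in>I. [:- v i, 1:]) k \<in> \<rat>"
proof -
  have fin: "finite I" using assms by (simp add: rational_family_def)
  have "reflect_poly (\<Prod>i\<in>I. [:1, - v i:]) = (\<Prod>i\<in>I. [:- v i, 1:])"
    using assms(2) by (simp add: reflect_poly_prod reflect_poly_linear' cong: prod.cong)
  then show ?thesis
    using assms(1) coeff_reflect_poly_Rats rational_family_iff[OF fin] by metis
qed

lemma rational_family_poly:
  assumes "rational_family I v" "\<And>i. i \<in> I \<Longrightarrow> v i \<noteq> 0"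
  obtains p where "cpoly p = (\<Prod>i\<in>I. [:- v i, 1:])"
  using rational_familyD[OF assms] by (metis ratpolyE)

text \<open>The power sums of the product family are products of power sums; a resultant argument
  becomes the distributive law.\<close>

lemma rational_family_times:
  assumes "rational_family I v" "rational_family J w"
  shows "rational_family (I \<times> J) (\<lambda>(i, j). v i * w j)"
proof -
  have "(\<Sum>(i, j)\<in>I \<times> J. (v i * w j) ^ k) = (\<Sum>i\<in>I. v i ^ k) * (\<Sum>j\<in>J. w j ^ k)" for k
    by (simp add: power_mult_distrib sum_product sum.cartesian_product)
  then show ?thesis
    using assms by (simp add: rational_family_def case_prod_unfold)
qed

lemma rational_family_PiE:
  assumes "finite A" "\<And>a. a \<in> A \<Longrightarrow> rational_family (S a) (\<lambda>z. z)"
  shows "rational_family (PiE A S) (\<lambda>J. \<Prod>a\<in>A. J a)"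
proof -
  have "(\<Sum>J\<in>PiE A S. (\<Prod>a\<in>A. J a) ^ k) = (\<Prod>a\<in>A. \<Sum>z\<in>S a. z ^ k)" for k
    using assms by (subst prod_sum_PiE) (auto simp: rational_family_def prod_power_distrib)
  moreover have "(\<Prod>a\<in>A. \<Sum>z\<in>S a. z ^ k) \<in> \<rat>" for k
    using assms(2) unfolding rational_family_def by (intro Rats_prod) auto
  ultimately show ?thesis
    using assms by (auto simp: rational_family_def intro: finite_PiE)
qed

text \<open>Since \<open>1 - X / v\<close> is \<open>X - v\<close> divided by \<open>- v\<close>,
  the reversed polynomial of the inverses is the ordinary polynomial of the values divided by its
  constant term, which is rational.\<close>

lemma rational_family_inverse:
  assumes "rational_family I v" "\<And>i. i \<in> I \<Longrightarrow> v i \<noteq> 0"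
  shows "rational_family I (\<lambda>i. inverse (v i))"
proof -
  have fin: "finite I" using assms by (simp add: rational_family_def)
  define c where "c = coeff (\<Prod>i\<in>I. [:- v i, 1:]) 0"
  have c: "c \<in> \<rat>" "c = (\<Prod>i\<in>I. - v i)"
    unfolding c_def by (rule rational_familyD[OF assms]; assumption) (simp add: poly_prod flip: poly_0_coeff_0)
  have "[:1, - inverse (v i):] = Polynomial.smult (inverse (- v i)) [:- v i, 1:]" if "i \<in> I" for i
    using assms(2)[OF that] by simp
  then have "(\<Prod>i\<in>I. [:1, - inverse (v i):]) = (\<Prod>i\<in>I. Polynomial.smult (inverse (- v i)) [:- v i, 1:])"
    by (intro prod.cong) auto
  also have "\<dots> = Polynomial.smult (inverse c) (\<Prod>i\<in>I. [:- v i, 1:])"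
    unfolding prod_smult c(2) by (subst prod_inversef [symmetric]) (simp add: o_def)
  finally show ?thesis
    using rational_familyD[OF assms] c(1) by (simp add: rational_family_iff[OF fin])
qed

section \<open>Conjugate algebraic numbers\<close>

definition roots :: "rat poly \<Rightarrow> complex set" where
  "roots h = {z. poly (cpoly h) z = 0}"

lemma cpoly_eq_0 [simp]: "cpoly p = 0 \<longleftrightarrow> p = 0"
  by (rule cpoly_hom.hom_0_iff)

lemma finite_roots: "h \<noteq> 0 \<Longrightarrow> finite (roots h)"
  by (simp add: roots_def poly_roots_finite)

lemma roots_mult: "roots (p * q) = roots p \<union> roots q"
  by (auto simp: roots_def cpoly_hom.hom_mult)

lemma roots_dvd: "p dvd q \<Longrightarrow> roots p \<subseteq> roots q"
  by (elim dvdE) (simp add: roots_mult)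

text \<open>A polynomial \<open>q\<close> of least degree vanishing at \<open>z\<close> divides
  every other such polynomial, by division with remainder. It divides \<open>h\<close> and is not a
  unit, so it is associated to \<open>h\<close>.\<close>

lemma irreducible_dvd:
  assumes h: "irreducible h" and z: "z \<in> roots h" "z \<in> roots p"
  shows "h dvd p"
proof -
  have h0: "h \<noteq> 0" using h by auto
  define A where "A = {q. q \<noteq> 0 \<and> z \<in> roots q}"
  have "h \<in> A" using h0 z by (simp add: A_def)
  then obtain q where q: "q \<in> A" and min: "\<And>q'. q' \<in> A \<Longrightarrow> degree q \<le> degree q'"
    using ex_has_least_nat[of "\<lambda>q. q \<in> A" h degree] by auto
  have q0: "q \<noteq> 0" and qz: "z \<in> roots q" using q by (auto simp: A_def)
  have dvd: "q dvd p'" if "z \<in> roots p'" for p'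
  proof (rule ccontr)
    assume "\<not> q dvd p'"
    then have r0: "p' mod q \<noteq> 0" by (simp add: dvd_eq_mod_eq_0)
    have "z \<in> roots s" if "p' = t * q + s" for t s
      using \<open>z \<in> roots p'\<close> qz
      by (simp add: that roots_def cpoly_hom.hom_add cpoly_hom.hom_mult)
    from this[of "p' div q"] have "z \<in> roots (p' mod q)" by simp
    then have "degree q \<le> degree (p' mod q)" using r0 min by (simp add: A_def)
    moreover have "degree (p' mod q) < degree q"
      using degree_mod_less[OF q0, of p'] r0 by blast
    ultimately show False by simp
  qed
  have "q dvd h" using dvd z by simp
  moreover have "\<not> q dvd 1"
  proof
    assume "q dvd 1"
    then have "roots q \<subseteq> roots 1" by (rule roots_dvd)
    with qz show False by (auto simp: roots_def)
  qed
  ultimately have "h dvd q" using irreducibleD'[OF h] by blast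
  with dvd[OF z(2)] show ?thesis by (rule dvd_trans[rotated])
qed

lemma root_irreducible:
  assumes "p \<noteq> 0" "z \<in> roots p"
  obtains h where "irreducible h" "z \<in> roots h" "h dvd p"
proof -
  have "\<exists>h. irreducible h \<and> z \<in> roots h \<and> h dvd p"
    using assms
  proof (induction "degree p" arbitrary: p rule: less_induct)
    case less
    show ?case
    proof (cases "irreducible p")
      case True
      with less show ?thesis by auto
    next
      case False
      have nc: "degree p \<noteq> 0"
      proof
        assume "degree p = 0"
        then obtain c where "p = [:c:]" by (metis degree_eq_zeroE)
        with less show False by (simp add: roots_def)
      qed
      then have "\<not> is_unit p" by (auto simp: is_unit_iff_degree less)
      with False less(2) obtain a b where ab: "p = a * b" "\<not> is_unit a" "\<not> is_unit b"
        unfolding irreducible_def by auto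
      have nz: "a \<noteq> 0" "b \<noteq> 0" using ab less(2) by auto
      then have "degree a \<noteq> 0" "degree b \<noteq> 0" using ab by (auto simp: is_unit_iff_degree)
      moreover have "degree p = degree a + degree b" using ab nz by (simp add: degree_mult_eq)
      moreover have "z \<in> roots a \<or> z \<in> roots b" using less(3) ab by (simp add: roots_mult)
      ultimately show ?thesis
        using less(1)[of a] less(1)[of b] nz ab by (metis dvd_mult dvd_mult2 less_add_same_cancel1
            less_add_same_cancel2 neq0_conv)
    qed
  qed
  then show ?thesis using that by auto
qed

lemma cpoly_pderiv: "pderiv (cpoly p) = cpoly (pderiv p)"
  by (simp add: of_rat_hom.map_poly_pderiv)

lemma irreducible_degree_pos: "irreducible (h :: rat poly) \<Longrightarrow> 0 < degree h"
  by (metis is_unit_iff_degree irreducible_def neq0_conv)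

text \<open>At a common root \<open>h\<close> would divide its derivative, which is nonzero of
  smaller degree. Simple roots are what allows \<open>roots h\<close> to be a set and still
  determine \<open>h\<close> up to a constant.\<close>

lemma irreducible_rsquarefree:
  assumes "irreducible h"
  shows "rsquarefree (cpoly h)"
  unfolding rsquarefree_roots
proof (intro allI notI)
  fix a assume a: "poly (cpoly h) a = 0 \<and> poly (pderiv (cpoly h)) a = 0"
  then have "h dvd pderiv h"
    by (intro irreducible_dvd[OF assms, of a]) (simp_all add: roots_def cpoly_pderiv)
  moreover have "pderiv h \<noteq> 0" "degree (pderiv h) < degree h"
    using irreducible_degree_pos[OF assms] by (simp_all add: pderiv_eq_0_iff degree_pderiv)
  ultimately show False using dvd_imp_degree_le by fastforce
qed

lemma irreducible_decompose:
  assumes "irreducible h"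
  shows "cpoly h = Polynomial.smult (lead_coeff (cpoly h)) (\<Prod>z\<in>roots h. [:- z, 1:])"
  using complex_poly_decompose_rsquarefree[OF irreducible_rsquarefree[OF assms]]
  by (simp add: roots_def)

lemma card_roots:
  assumes "irreducible h"
  shows "card (roots h) = degree h"
proof -
  have "degree (cpoly h) = degree (\<Prod>z\<in>roots h. [:- z, 1:])"
    using irreducible_decompose[OF assms] assms
    by (metis cpoly_eq_0 degree_smult_eq leading_coeff_0_iff not_irreducible_zero)
  also have "\<dots> = card (roots h)" by (subst degree_prod_sum_eq) auto
  finally show ?thesis by simp
qed

lemma rational_family_roots:
  assumes "irreducible h"
  shows "rational_family (roots h) (\<lambda>z. z)"
proof (rule rational_familyI)
  have h0: "h \<noteq> 0" using assms by auto
  then show "finite (roots h)" by (rule finite_roots)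
  fix k
  have "Polynomial.smult (inverse (lead_coeff (cpoly h))) (cpoly h) = (\<Prod>z\<in>roots h. [:- z, 1:])"
    using h0 by (subst (2) irreducible_decompose[OF assms]) simp
  then have "coeff (\<Prod>z\<in>roots h. [:- z, 1:]) k = inverse (lead_coeff (cpoly h)) * coeff (cpoly h) k"
    by (metis coeff_smult)
  also have "\<dots> \<in> \<rat>" by simp
  finally show "coeff (\<Prod>z\<in>roots h. [:- z, 1:]) k \<in> \<rat>" .
qed

text \<open>Strip factors \<open>h\<close> from \<open>p\<close>: each contributes 1 to both orders,
  and once \<open>h\<close> no longer divides, neither number is a root.\<close>

lemma order_conjugate:
  assumes h: "irreducible h" "c \<in> roots h" "c' \<in> roots h"
  shows "p \<noteq> 0 \<Longrightarrow> order c (cpoly p) = Polynomial.order c' (cpoly p)"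
proof (induction "degree p" arbitrary: p rule: less_induct)
  case less
  show ?case
  proof (cases "h dvd p")
    case True
    then obtain q where q: "p = h * q" by (auto elim: dvdE)
    have nz: "h \<noteq> 0" "q \<noteq> 0" using q less by auto
    have one: "Polynomial.order z (cpoly h) = 1" if "z \<in> roots h" for z
      using irreducible_rsquarefree[OF h(1)] that
      by (intro rsquarefree_root_order) (use nz in \<open>simp_all add: roots_def\<close>)
    have ord: "Polynomial.order z (cpoly p) = Polynomial.order z (cpoly h) + Polynomial.order z (cpoly q)" for z
      unfolding q cpoly_hom.hom_mult using nz by (intro order_mult) simp
    have "degree q < degree p"
      using q nz irreducible_degree_pos[OF h(1)] by (simp add: degree_mult_eq)
    then show ?thesis using less(1)[of q] nz one h(2,3) by (simp add: ord)
  next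
    case False
    then have "c \<notin> roots p" "c' \<notin> roots p" using irreducible_dvd h by blast+
    then show ?thesis by (simp add: roots_def order_root order_0I)
  qed
qed

section \<open>Multiplicities in rational families\<close>

lemma order_prod_linear:
  fixes v :: "'i \<Rightarrow> complex"
  assumes "finite I"
  shows "Polynomial.order c (\<Prod>i\<in>I. [:- v i, 1:]) = card {i\<in>I. v i = c}"
  using assms
proof (induction I rule: finite_induct)
  case empty
  then show ?case by (simp add: order_0I)
next
  case (insert x I)
  have "Polynomial.order c (\<Prod>i\<in>insert x I. [:- v i, 1:]) = Polynomial.order c [:- v x, 1:] + Polynomial.order c (\<Prod>i\<in>I. [:- v i, 1:])"
    using insert by (simp del: mult_pCons_left add: order_mult)
  also have "Polynomial.order c [:- v x, 1:] = (if v x = c then 1 else 0)"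
    by (simp add: order_linear')
  moreover have "{i\<in>insert x I. v i = c} = (if v x = c then insert x {i\<in>I. v i = c} else {i\<in>I. v i = c})"
    by auto
  ultimately show ?case using insert by simp
qed

text \<open>This takes the place of a field automorphism carrying \<open>c\<close> to
  \<open>c'\<close>: the family lists the roots of a rational polynomial with multiplicity.\<close>

lemma card_conjugate:
  assumes "rational_family I v" "\<And>i. i \<in> I \<Longrightarrow> v i \<noteq> 0"
    and "irreducible h" "c \<in> roots h" "c' \<in> roots h"
  shows "card {i\<in>I. v i = c} = card {i\<in>I. v i = c'}"
proof -
  obtain p where p: "cpoly p = (\<Prod>i\<in>I. [:- v i, 1:])"
    using rational_family_poly assms(1,2) by metis
  have fin: "finite I" using assms by (simp add: rational_family_def)
  have "cpoly p \<noteq> 0" unfolding p using fin by simp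
  then have "p \<noteq> 0" by auto
  then show ?thesis
    using order_conjugate[OF assms(3-5), of p] by (simp add: p order_prod_linear[OF fin])
qed

lemma rational_family_irreducible:
  assumes "rational_family I v" "\<And>i. i \<in> I \<Longrightarrow> v i \<noteq> 0" "i \<in> I"
  obtains h where "irreducible h" "v i \<in> roots h" "0 \<notin> roots h"
proof -
  obtain p where p: "cpoly p = (\<Prod>i\<in>I. [:- v i, 1:])"
    using rational_family_poly assms(1,2) by metis
  have fin: "finite I" using assms by (simp add: rational_family_def)
  have "cpoly p \<noteq> 0" unfolding p using fin by simp
  then have "p \<noteq> 0" by auto
  moreover have "v i \<in> roots p" using fin assms(3) by (auto simp: roots_def p poly_prod)
  ultimately obtain h where h: "irreducible h" "v i \<in> roots h" "h dvd p"
    by (rule root_irreducible)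
  have "0 \<notin> roots p" using fin assms(2) by (simp add: roots_def p poly_prod)
  with roots_dvd[OF h(3)] have "0 \<notin> roots h" by auto
  with h show ?thesis using that by blast
qed

text \<open>Count the pairs \<open>(b, z)\<close> of roots of \<open>g\<close> and \<open>f\<close> with \<open>z / b\<close> conjugate to \<open>l / a\<close>: each \<open>b\<close> has the
  same number of partners, and so has each \<open>z\<close>; as the degrees are coprime, all pairs occur.\<close>

lemma quotient_conjugate:
  assumes g: "irreducible g" "0 \<notin> roots g" and f: "irreducible f" "0 \<notin> roots f"
    and cop: "coprime (degree g) (degree f)"
    and a: "a \<in> roots g" "a' \<in> roots g" and l: "l \<in> roots f"
  obtains h where "irreducible h" "l / a \<in> roots h" "l / a' \<in> roots h"
proof -
  have ratg: "rational_family (roots g) (\<lambda>z. z)" and ratf: "rational_family (roots f) (\<lambda>z. z)"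
    using g f by (simp_all add: rational_family_roots)
  have nzg: "\<And>b. b \<in> roots g \<Longrightarrow> b \<noteq> 0" and nzf: "\<And>z. z \<in> roots f \<Longrightarrow> z \<noteq> 0"
    using g f by auto
  have fing: "finite (roots g)" and finf: "finite (roots f)"
    using ratg ratf by (simp_all add: rational_family_def)
  obtain h where h: "irreducible h" "l / a \<in> roots h" "0 \<notin> roots h"
  proof -
    have "rational_family (roots f \<times> roots g) (\<lambda>(z, b). z * inverse b)"
      by (intro rational_family_times ratf rational_family_inverse ratg nzg)
    then obtain h where "irreducible h" "l * inverse a \<in> roots h" "0 \<notin> roots h"
      by (rule rational_family_irreducible[of _ _ "(l, a)"]) (use a l nzg nzf in auto)
    then show ?thesis using that by (simp add: divide_inverse)
  qed
  define C where "C = roots h"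
  have nzC: "\<And>c. c \<in> C \<Longrightarrow> c \<noteq> 0" using h by (auto simp: C_def)
  have ratC: "rational_family C (\<lambda>z. z)" using h by (simp add: C_def rational_family_roots)
  define s where "s z = card {b\<in>roots g. z / b \<in> C}" for z
  define t where "t b = card {z\<in>roots f. z / b \<in> C}" for b
  have s_eq: "s z = s l" if z: "z \<in> roots f" for z
  proof -
    \<comment> \<open>A partner \<open>b\<close> of \<open>z\<close> is a factorization
      \<open>z = b * c\<close> with \<open>c\<close> in \<open>C\<close>, so \<open>s z\<close> is a
      multiplicity in a product family and is invariant under conjugation of
      \<open>z\<close>.\<close>
    have "s z = card {i\<in>roots g \<times> C. (case i of (b, c) \<Rightarrow> b * c) = z}" if "z \<in> roots f" for z
      unfolding s_def
      by (rule bij_betw_same_card[of "\<lambda>b. (b, z / b)"], rule bij_betwI[where g = fst])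
        (use nzg nzC in auto)
    moreover have "card {i\<in>roots g \<times> C. (case i of (b, c) \<Rightarrow> b * c) = z} =
        card {i\<in>roots g \<times> C. (case i of (b, c) \<Rightarrow> b * c) = l}"
      by (intro card_conjugate[OF _ _ f(1)] rational_family_times ratg ratC z l)
        (use nzg nzC in auto)
    ultimately show ?thesis using z l by simp
  qed
  have t_eq: "t b = t a" if b: "b \<in> roots g" for b
  proof -
    have "t b = card {i\<in>roots f \<times> C. (case i of (z, c) \<Rightarrow> z * inverse c) = b}" if "b \<in> roots g" for b
      unfolding t_def
      by (rule bij_betw_same_card[of "\<lambda>z. (z, z / b)"], rule bij_betwI[where g = fst])
        (use nzg[OF that] nzf nzC in \<open>auto simp: field_simps\<close>)
    moreover have "card {i\<in>roots f \<times> C. (case i of (z, c) \<Rightarrow> z * inverse c) = b} =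
        card {i\<in>roots f \<times> C. (case i of (z, c) \<Rightarrow> z * inverse c) = a}"
      by (intro card_conjugate[OF _ _ g(1)] rational_family_times ratf
          rational_family_inverse ratC b a(1)) (use nzf nzC in auto)
    ultimately show ?thesis using b a by simp
  qed
  have "(\<Sum>z\<in>roots f. s z) = (\<Sum>z\<in>roots f. \<Sum>b | b \<in> roots g \<and> z / b \<in> C. 1)"
    by (simp add: s_def)
  also have "\<dots> = (\<Sum>b\<in>roots g. \<Sum>z | z \<in> roots f \<and> z / b \<in> C. 1)"
    by (rule sum.swap_restrict[OF finf fing])
  also have "\<dots> = (\<Sum>b\<in>roots g. t b)"
    by (simp add: t_def)
  finally have "degree f * s l = degree g * t a"
    using s_eq t_eq by (simp add: card_roots f g)
  then have "degree g dvd degree f * s l" by simp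
  then have "degree g dvd s l"
    using cop by (simp add: GCD.coprime_dvd_mult_right_iff)
  \<comment> \<open>The root \<open>a\<close> is a partner of \<open>l\<close>. So
    \<open>s l\<close> is a positive multiple of \<open>degree g\<close>, and it cannot exceed
    \<open>degree g\<close>.\<close>
  moreover have "0 < s l"
    unfolding s_def using a h fing by (auto simp: card_gt_0_iff C_def)
  moreover have "s l \<le> degree g"
    unfolding s_def card_roots[OF g(1), symmetric] by (intro card_mono fing) auto
  ultimately have "card {b\<in>roots g. l / b \<in> C} = card (roots g)"
    by (simp add: s_def card_roots g(1) dvd_imp_le order_antisym)
  then have "{b\<in>roots g. l / b \<in> C} = roots g"
    by (intro card_subset_eq fing) auto
  then have "l / a' \<in> C" using a by auto
  with h show ?thesis using that by (simp add: C_def)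
qed

text \<open>Averaging \<open>l = \<Prod>k. J k\<close> over all such factorizations of \<open>l\<close>: by \<open>quotient_conjugate\<close> each
  root of \<open>g k\<close> is the \<open>k\<close>-th factor equally often, so \<open>\<bar>l\<bar>\<close> is a product of powers of norms.\<close>

lemma norm_prod_roots_eq_1:
  assumes A: "finite A"
    and g: "\<And>k. k \<in> A \<Longrightarrow> irreducible (g k) \<and> 0 \<notin> roots (g k) \<and> coprime (degree (g k)) (degree f)
      \<and> (\<Prod>z\<in>roots (g k). cmod z) = 1"
    and f: "irreducible f"
    and J0: "\<And>k. k \<in> A \<Longrightarrow> J0 k \<in> roots (g k)" and l: "(\<Prod>k\<in>A. J0 k) \<in> roots f"
  shows "cmod (\<Prod>k\<in>A. J0 k) = 1"
proof -
  define S where "S k = roots (g k)" for k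
  define l where "l = (\<Prod>k\<in>A. J0 k)"
  define X where "X = {J\<in>PiE A S. (\<Prod>k\<in>A. J k) = l}"
  have nz: "z \<noteq> 0" if "k \<in> A" "z \<in> S k" for k z
    using g[OF that(1)] that(2) by (auto simp: S_def)
  have finS: "finite (S k)" if "k \<in> A" for k
    using g[OF that] unfolding S_def by (intro finite_roots) auto
  have finX: "finite X"
    unfolding X_def
    by (rule finite_subset[of _ "PiE A S"]) (use A finS in \<open>auto intro: finite_PiE\<close>)
  have l0: "l \<noteq> 0"
    unfolding l_def using nz J0 A by (auto simp: S_def)
  have lf: "l \<in> roots f" using l by (simp add: l_def)
  \<comment> \<open>An irreducible \<open>f\<close> with root 0 divides \<open>X\<close>, so 0 would
    be its only root, but the nonzero \<open>l\<close> is one.\<close>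
  have f0: "0 \<notin> roots f"
  proof
    assume 0: "0 \<in> roots f"
    then have "f dvd [:0, 1:]"
      by (rule irreducible_dvd[OF f]) (simp add: roots_def)
    then have "roots f \<subseteq> roots [:0, 1:]" by (rule roots_dvd)
    then show False using lf l0 by (auto simp: roots_def)
  qed
  \<comment> \<open>The given factorization makes \<open>X\<close> nonempty, so
    \<open>card X\<close> can be cancelled at the end. Restriction to \<open>A\<close> gives the
    default value outside \<open>A\<close> that \<open>PiE\<close> demands.\<close>
  have XJ0: "restrict J0 A \<in> X"
    using J0 by (auto simp: X_def S_def l_def)
  have avg: "(\<Sum>J\<in>X. ln (cmod (J k))) = 0" if k: "k \<in> A" for k
  proof -
    let ?B = "A - {k}"
    let ?m = "\<lambda>a. card {J\<in>PiE ?B S. (\<Prod>j\<in>?B. J j) = l / a}"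
    \<comment> \<open>Once the \<open>k\<close>-th factor is fixed to be \<open>a\<close>, the
      others form a factorization of \<open>l / a\<close>. This count depends on \<open>a\<close>
      only through a number whose conjugacy class is known.\<close>
    have cnt: "card {J\<in>X. J k = a} = ?m a" if a: "a \<in> S k" for a
    proof (rule bij_betw_same_card[of "\<lambda>J. restrict J ?B"],
        rule bij_betwI[where g = "\<lambda>J. J(k := a)"])
      have prodA: "(\<Prod>j\<in>A. J j) = J k * (\<Prod>j\<in>?B. J j)" for J :: "_ \<Rightarrow> complex"
        using A k by (simp add: prod.remove)
      show "(\<lambda>J. restrict J ?B) \<in> {J \<in> X. J k = a} \<rightarrow> {J\<in>PiE ?B S. (\<Prod>j\<in>?B. J j) = l / a}"
        using nz[OF k a] by (auto simp: X_def prodA PiE_iff split: if_splits)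
      show "(\<lambda>J. J(k := a)) \<in> {J\<in>PiE ?B S. (\<Prod>j\<in>?B. J j) = l / a} \<rightarrow> {J \<in> X. J k = a}"
      proof
        fix J assume J: "J \<in> {J\<in>PiE ?B S. (\<Prod>j\<in>?B. J j) = l / a}"
        have "(\<Prod>j\<in>?B. (J(k := a)) j) = (\<Prod>j\<in>?B. J j)" by (rule prod.cong) auto
        moreover have "J(k := a) \<in> PiE A S"
          using J a k by (auto simp: PiE_iff extensional_def)
        ultimately show "J(k := a) \<in> {J \<in> X. J k = a}"
          using J nz[OF k a] by (simp add: X_def prodA)
      qed
      show "(restrict J ?B)(k := a) = J" if "J \<in> {J \<in> X. J k = a}" for J
        using that by (auto simp: X_def PiE_def extensional_def fun_eq_iff)
      show "restrict (J(k := a)) ?B = J" if "J \<in> {J\<in>PiE ?B S. (\<Prod>j\<in>?B. J j) = l / a}" for J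
        using that by (auto simp: PiE_def extensional_def fun_eq_iff)
    qed
    have const: "?m a = ?m (J0 k)" if a: "a \<in> S k" for a
    proof -
      obtain h where h: "irreducible h" "l / a \<in> roots h" "l / J0 k \<in> roots h"
        using quotient_conjugate[OF _ _ f f0 _ _ _ lf, of "g k" a "J0 k"] g[OF k] J0[OF k] a
        by (auto simp: S_def)
      show ?thesis
      proof (rule card_conjugate[OF _ _ h])
        show "rational_family (PiE ?B S) (\<lambda>J. \<Prod>j\<in>?B. J j)"
          by (rule rational_family_PiE) (use A g in \<open>auto simp: S_def intro: rational_family_roots\<close>)
        show "(\<Prod>j\<in>?B. J j) \<noteq> 0" if "J \<in> PiE ?B S" for J
          using that nz A by (auto simp: PiE_iff)
      qed
    qed
    have "(\<Sum>J\<in>X. ln (cmod (J k))) = (\<Sum>a\<in>S k. \<Sum>J | J \<in> X \<and> J k = a. ln (cmod (J k)))"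
      by (rule sum.group[symmetric]) (use finX finS[OF k] k in \<open>auto simp: X_def\<close>)
    also have "\<dots> = (\<Sum>a\<in>S k. ?m (J0 k) * ln (cmod a))"
    proof (rule sum.cong[OF refl])
      fix a assume a: "a \<in> S k"
      have "(\<Sum>J | J \<in> X \<and> J k = a. ln (cmod (J k))) = card {J\<in>X. J k = a} * ln (cmod a)"
        by simp
      then show "(\<Sum>J | J \<in> X \<and> J k = a. ln (cmod (J k))) = ?m (J0 k) * ln (cmod a)"
        using cnt[OF a] const[OF a] by simp
    qed
    \<comment> \<open>Equal weights collapse the sum to the logarithm of the norm of
      \<open>g k\<close>, which is 1.\<close>
    also have "\<dots> = ?m (J0 k) * ln (\<Prod>a\<in>S k. cmod a)"
      using nz[OF k] finS[OF k] by (simp add: ln_prod sum_distrib_left)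
    also have "\<dots> = 0"
      using g[OF k] by (simp add: S_def)
    finally show ?thesis .
  qed
  have "card X * ln (cmod l) = (\<Sum>J\<in>X. ln (cmod (\<Prod>k\<in>A. J k)))"
    by (simp add: X_def)
  also have "\<dots> = (\<Sum>J\<in>X. \<Sum>k\<in>A. ln (cmod (J k)))"
  proof (rule sum.cong[OF refl])
    fix J assume "J \<in> X"
    then have "\<And>k. k \<in> A \<Longrightarrow> J k \<noteq> 0" using nz by (auto simp: X_def)
    then show "ln (cmod (\<Prod>k\<in>A. J k)) = (\<Sum>k\<in>A. ln (cmod (J k)))"
      using A by (simp add: ln_prod flip: prod_norm)
  qed
  also have "\<dots> = (\<Sum>k\<in>A. \<Sum>J\<in>X. ln (cmod (J k)))" by (rule sum.swap)
  also have "\<dots> = 0" using avg by simp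
  finally have "ln (cmod l) = 0"
    using finX XJ0 by auto
  then show ?thesis using l0 by (simp add: l_def)
qed

section \<open>Units and degrees\<close>

text \<open>By Gauss's lemma \<open>g\<close> is a rational multiple of an integer factor
  \<open>G\<close> of \<open>p\<close>. The leading and constant coefficients of \<open>G\<close>
  divide units, and by Vieta their quotient is the product of the roots up to sign.\<close>

lemma norm_prod_roots_int_factor:
  fixes p :: "int poly"
  assumes p: "lead_coeff p = 1" "\<bar>coeff p 0\<bar> = 1"
    and g: "irreducible g" "g dvd map_poly rat_of_int p"
  shows "0 \<notin> roots g" "(\<Prod>z\<in>roots g. cmod z) = 1"
proof -
  obtain h where h: "map_poly rat_of_int p = g * h" using g(2) by (elim dvdE)
  obtain r G where rG: "rat_to_normalized_int_poly g = (r, G)" by force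
  have gr: "g = Polynomial.smult r (map_poly rat_of_int G)"
    using rat_to_normalized_int_poly(1)[OF rG] .
  obtain H where "p = G * Polynomial.smult (content p) H"
    using rat_to_int_factor_explicit[OF h rG] by blast
  then obtain H where H: "p = G * H" by blast
  have unit: "\<bar>a\<bar> = 1" if "\<bar>a * b\<bar> = 1" for a b :: int
    using that by (rule abs_zmult_eq_1)
  have lc: "\<bar>lead_coeff G\<bar> = 1"
    by (rule unit[of _ "lead_coeff H"]) (use p(1) in \<open>simp add: H lead_coeff_mult\<close>)
  have c0: "\<bar>coeff G 0\<bar> = 1"
    by (rule unit[of _ "coeff H 0"]) (use p(2) in \<open>simp add: H coeff_mult_0\<close>)
  have r0: "r \<noteq> 0" using g(1) gr by auto
  have "coeff (cpoly g) 0 = of_rat r * of_int (coeff G 0)"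
    by (simp add: gr of_rat_mult)
  moreover have "lead_coeff (cpoly g) = of_rat r * of_int (lead_coeff G)"
    using r0 by (simp add: gr of_rat_mult)
  moreover have "coeff (cpoly g) 0 = lead_coeff (cpoly g) * (\<Prod>z\<in>roots g. - z)"
    by (subst irreducible_decompose[OF g(1)])
      (simp add: poly_prod flip: poly_0_coeff_0)
  ultimately have "of_int (coeff G 0) = of_int (lead_coeff G) * (\<Prod>z\<in>roots g. - z)"
    using r0 by simp
  then have "cmod (of_int (coeff G 0)) = cmod (of_int (lead_coeff G)) * cmod (\<Prod>z\<in>roots g. - z)"
    by (metis norm_mult)
  then have "real_of_int \<bar>coeff G 0\<bar> = real_of_int \<bar>lead_coeff G\<bar> * (\<Prod>z\<in>roots g. cmod z)"
    by (simp add: norm_of_int flip: prod_norm)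
  then show *: "(\<Prod>z\<in>roots g. cmod z) = 1" by (simp add: lc c0)
  have "finite (roots g)" using g(1) by (intro finite_roots) auto
  with * show "0 \<notin> roots g" by (metis norm_zero prod_zero zero_neq_one)
qed

lemma exists_irreducible_factor:
  fixes q :: "rat poly"
  assumes "q \<noteq> 0" "degree q \<noteq> 0"
  obtains h where "irreducible h" "h dvd q"
proof -
  have "\<not> constant (poly (cpoly q))" using assms by (simp add: constant_degree)
  then obtain z where "z \<in> roots q"
    using fundamental_theorem_of_algebra by (auto simp: roots_def)
  from root_irreducible[OF assms(1) this] show ?thesis using that by blast
qed

lemma dvd_degree_irreducible_factors:
  assumes "q \<noteq> 0" "\<And>h. irreducible h \<Longrightarrow> h dvd q \<Longrightarrow> m dvd degree (h :: rat poly)"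
  shows "m dvd degree q"
  using assms
proof (induction "degree q" arbitrary: q rule: less_induct)
  case less
  show ?case
  proof (cases "degree q = 0")
    case False
    then obtain h where h: "irreducible h" "h dvd q"
      using exists_irreducible_factor less by metis
    then obtain k where k: "q = h * k" by (elim dvdE)
    have nz: "h \<noteq> 0" "k \<noteq> 0" using k less(2) by auto
    then have deg: "degree q = degree h + degree k" using k by (simp add: degree_mult_eq)
    have "m dvd degree k"
    proof (rule less(1))
      show "degree k < degree q" using deg irreducible_degree_pos[OF h(1)] by simp
      show "m dvd degree h" if "irreducible h" "h dvd k" for h
        using less(3) that k by simp
    qed (use nz in simp)
    with deg less(3)[OF h] show ?thesis by simp
  qed simp
qed

text \<open>A power of \<open>m\<close> is coprime to every degree that \<open>m\<close> does not
  divide. An irreducible factor of \<open>q\<close> with such a degree would have all its roots on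
  the unit circle by \<open>norm_prod_roots_eq_1\<close>.\<close>

lemma prime_dvd_degree:
  assumes m: "prime m" and "q \<noteq> 0" "P \<noteq> 0"
    and P: "\<And>g. irreducible g \<Longrightarrow> g dvd P \<Longrightarrow>
      (\<exists>j. degree g = m ^ j) \<and> 0 \<notin> roots g \<and> (\<Prod>z\<in>roots g. cmod z) = 1"
    and q: "\<And>l. l \<in> roots q \<Longrightarrow> cmod l \<noteq> 1 \<and> (\<exists>\<alpha>. (\<forall>k<n::nat. \<alpha> k \<in> roots P) \<and> l = (\<Prod>k<n. \<alpha> k))"
  shows "m dvd degree q"
proof (rule dvd_degree_irreducible_factors)
  fix f assume f: "irreducible f" "f dvd q"
  have "card (roots f) \<noteq> 0" using card_roots[OF f(1)] irreducible_degree_pos[OF f(1)] by simp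
  then obtain l where l: "l \<in> roots f" by fastforce
  then have "l \<in> roots q" using roots_dvd f(2) by blast
  from q[OF this] obtain \<alpha> where ne: "cmod l \<noteq> 1"
    and \<alpha>: "\<And>k. k < n \<Longrightarrow> \<alpha> k \<in> roots P" "l = (\<Prod>k<n. \<alpha> k)" by blast
  have "\<exists>g. irreducible g \<and> \<alpha> k \<in> roots g \<and> g dvd P" if "k < n" for k
    using root_irreducible[OF assms(3) \<alpha>(1)[OF that]] by blast
  then obtain g where g: "\<And>k. k < n \<Longrightarrow> irreducible (g k) \<and> \<alpha> k \<in> roots (g k) \<and> g k dvd P"
    by metis
  show "m dvd degree f"
  proof (rule ccontr)
    assume "\<not> m dvd degree f"
    then have cop: "coprime (m ^ j) (degree f)" for j
      using m by (simp add: prime_imp_coprime)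
    have "coprime (degree (g k)) (degree f)" if "k < n" for k
      using g[OF that] P[of "g k"] cop by fastforce
    then have "cmod (\<Prod>k\<in>{..<n}. \<alpha> k) = 1"
      by (intro norm_prod_roots_eq_1[of _ g f]) (use g P f(1) l \<alpha>(2) in auto)
    with ne \<alpha>(2) show False by simp
  qed
qed (use assms in simp)

section \<open>Polynomials in a linear map\<close>

definition poly_map :: "real poly \<Rightarrow> ('a::real_vector \<Rightarrow> 'a) \<Rightarrow> 'a \<Rightarrow> 'a" where
  "poly_map p T x = (\<Sum>k\<le>degree p. coeff p k *\<^sub>R (T ^^ k) x)"

lemma poly_map_eq:
  assumes "degree p \<le> n"
  shows "poly_map p T x = (\<Sum>k\<le>n. coeff p k *\<^sub>R (T ^^ k) x)"
  unfolding poly_map_def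
  by (rule sum.mono_neutral_left) (use assms in \<open>auto simp: coeff_eq_0\<close>)

lemma poly_map_0 [simp]: "poly_map 0 T x = 0"
  by (simp add: poly_map_def)

lemma linear_funpow:
  fixes T :: "'a::real_vector \<Rightarrow> 'a"
  shows "linear T \<Longrightarrow> linear (T ^^ k)"
  by (induction k) (auto intro!: linearI simp: linear_add linear_scale)

lemma poly_map_pCons:
  assumes "linear T"
  shows "poly_map (pCons a p) T x = a *\<^sub>R x + T (poly_map p T x)"
proof -
  have "poly_map (pCons a p) T x = (\<Sum>k\<le>Suc (degree p). coeff (pCons a p) k *\<^sub>R (T ^^ k) x)"
    by (rule poly_map_eq) (simp add: degree_pCons_le)
  also have "\<dots> = a *\<^sub>R x + (\<Sum>k\<le>degree p. coeff p k *\<^sub>R T ((T ^^ k) x))"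
    by (subst sum.atMost_Suc_shift) simp
  finally show ?thesis
    by (simp add: poly_map_def linear_sum[OF assms] linear_scale[OF assms])
qed

lemma poly_map_add: "poly_map (p + q) T x = poly_map p T x + poly_map q T x"
proof -
  define n where "n = max (degree p) (degree q)"
  have "degree (p + q) \<le> n" "degree p \<le> n" "degree q \<le> n"
    by (auto simp: n_def degree_add_le_max)
  then show ?thesis
    by (simp add: poly_map_eq[of _ n] scaleR_add_left sum.distrib)
qed

lemma poly_map_smult: "poly_map (Polynomial.smult a p) T x = a *\<^sub>R poly_map p T x"
  by (subst poly_map_eq[of _ "degree p"]) (simp_all add: poly_map_def scaleR_sum_right)

lemma poly_map_sum: "poly_map (\<Sum>i\<in>I. p i) T x = (\<Sum>i\<in>I. poly_map (p i) T x)"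
  by (induction I rule: infinite_finite_induct) (simp_all add: poly_map_add)

lemma poly_map_linear:
  assumes "linear T"
  shows "linear (poly_map p T)"
proof -
  interpret linear "T ^^ k" for k using assms by (rule linear_funpow)
  show ?thesis
    by (rule linearI)
      (simp_all add: poly_map_def add scale scaleR_add_right sum.distrib scaleR_sum_right mult.commute)
qed

lemma poly_map_mult:
  assumes "linear T"
  shows "poly_map (p * q) T x = poly_map p T (poly_map q T x)"
  by (induction p)
    (simp_all add: poly_map_add poly_map_smult poly_map_pCons[OF assms] mult_pCons_left)

lemma poly_map_mem:
  assumes "subspace U" "\<And>x. x \<in> U \<Longrightarrow> T x \<in> U" "x \<in> U"
  shows "poly_map p T x \<in> U"
proof -
  have "(T ^^ k) x \<in> U" for k using assms by (induction k) auto
  then show ?thesis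
    unfolding poly_map_def using assms(1) by (auto intro: subspace_sum subspace_scale)
qed

text \<open>Cayley--Hamilton modulo an invariant subspace, by the adjugate of the characteristic matrix.\<close>

lemma char_poly_map_mem:
  fixes T :: "'a::real_vector \<Rightarrow> 'a"
  assumes T: "linear T" and U: "subspace U" "\<And>x. x \<in> U \<Longrightarrow> T x \<in> U"
    and A: "A \<in> carrier_mat n n"
    and e: "\<And>j. j < n \<Longrightarrow> T (e j) - (\<Sum>i<n. A $$ (i, j) *\<^sub>R e i) \<in> U" and k: "k < n"
  shows "poly_map (char_poly A) T (e k) \<in> U"
proof -
  define B where "B = char_poly_matrix A"
  define C where "C = adj_mat B"
  have B: "B \<in> carrier_mat n n" using A by (simp add: B_def)
  have C: "C \<in> carrier_mat n n" using adj_mat(1)[OF B] by (simp add: C_def)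
  have BC: "B * C = char_poly A \<cdot>\<^sub>m 1\<^sub>m n"
    using adj_mat(2)[OF B] by (simp add: C_def B_def char_poly_def)
  have BC': "(\<Sum>j<n. C $$ (j, k) * B $$ (i, j)) = (if i = k then char_poly A else 0)" if "i < n" for i
  proof -
    have "(\<Sum>j<n. C $$ (j, k) * B $$ (i, j)) = (B * C) $$ (i, k)"
      using B C k that by (simp add: scalar_prod_def atLeast0LessThan mult.commute)
    then show ?thesis
      using that k by (simp add: BC)
  qed
  have Bij: "B $$ (i, j) = (if i = j then [:0, 1:] else 0) + [:- A $$ (i, j):]" if "i < n" "j < n" for i j
    using A that by (auto simp: B_def char_poly_matrix_def)
  \<comment> \<open>Column \<open>j\<close> of the characteristic matrix, applied to the vectors
    \<open>e i\<close>, is exactly the defect that is assumed to lie in \<open>U\<close>. Column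
    \<open>k\<close> of the adjugate then combines these defects into \<open>char_poly A\<close>
    applied to \<open>e k\<close>.\<close>
  have col: "(\<Sum>i<n. poly_map (B $$ (i, j)) T (e i)) \<in> U" if j: "j < n" for j
  proof -
    have "(\<Sum>i<n. poly_map (B $$ (i, j)) T (e i)) =
        (\<Sum>i<n. (if i = j then T (e j) else 0) - A $$ (i, j) *\<^sub>R e i)"
      by (intro sum.cong refl)
        (use j in \<open>auto simp: Bij poly_map_add poly_map_pCons[OF T] linear_0[OF T]\<close>)
    also have "\<dots> = T (e j) - (\<Sum>i<n. A $$ (i, j) *\<^sub>R e i)"
      using j by (simp add: sum_subtractf)
    finally show ?thesis using e[OF j] by simp
  qed
  have "(\<Sum>j<n. poly_map (C $$ (j, k)) T (\<Sum>i<n. poly_map (B $$ (i, j)) T (e i))) \<in> U"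
    by (intro subspace_sum U poly_map_mem col) auto
  also have "(\<Sum>j<n. poly_map (C $$ (j, k)) T (\<Sum>i<n. poly_map (B $$ (i, j)) T (e i))) =
      (\<Sum>j<n. \<Sum>i<n. poly_map (C $$ (j, k) * B $$ (i, j)) T (e i))"
    by (simp add: poly_map_mult[OF T] linear_sum[OF poly_map_linear[OF T]])
  also have "\<dots> = (\<Sum>i<n. poly_map (\<Sum>j<n. C $$ (j, k) * B $$ (i, j)) T (e i))"
    by (subst sum.swap) (simp add: poly_map_sum)
  also have "\<dots> = (\<Sum>i<n. if i = k then poly_map (char_poly A) T (e k) else 0)"
    by (intro sum.cong refl) (auto simp: BC')
  also have "\<dots> = poly_map (char_poly A) T (e k)" using k by simp
  finally show ?thesis .
qed

text \<open>A polynomial in the transpose of \<open>T\<close>. Acting on functionals admits complex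
  coefficients, which cannot act on the real space itself.\<close>

definition form_map :: "complex poly \<Rightarrow> ('a \<Rightarrow> 'a) \<Rightarrow> ('a \<Rightarrow> complex) \<Rightarrow> 'a \<Rightarrow> complex" where
  "form_map p T \<psi> x = (\<Sum>k\<le>degree p. coeff p k * \<psi> ((T ^^ k) x))"

lemma form_map_linear_factor:
  assumes "p \<noteq> 0"
  shows "form_map ([:- a, 1:] * p) T \<psi> x = form_map p T (\<lambda>x. \<psi> (T x) - a * \<psi> x) x"
proof -
  have deg: "degree ([:- a, 1:] * p) = Suc (degree p)"
    using assms by (subst degree_mult_eq) auto
  have c: "coeff ([:- a, 1:] * p) k = (case k of 0 \<Rightarrow> 0 | Suc j \<Rightarrow> coeff p j) - a * coeff p k" for k
    by (cases k) (simp_all add: mult_pCons_left)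
  have "form_map ([:- a, 1:] * p) T \<psi> x =
      (\<Sum>k\<le>Suc (degree p). (case k of 0 \<Rightarrow> 0 | Suc j \<Rightarrow> coeff p j) * \<psi> ((T ^^ k) x))
      - (\<Sum>k\<le>Suc (degree p). a * coeff p k * \<psi> ((T ^^ k) x))"
    unfolding form_map_def deg c by (simp add: left_diff_distrib sum_subtractf)
  also have "(\<Sum>k\<le>Suc (degree p). (case k of 0 \<Rightarrow> 0 | Suc j \<Rightarrow> coeff p j) * \<psi> ((T ^^ k) x)) =
      (\<Sum>k\<le>degree p. coeff p k * \<psi> (T ((T ^^ k) x)))"
    by (subst sum.atMost_Suc_shift) simp
  also have "(\<Sum>k\<le>Suc (degree p). a * coeff p k * \<psi> ((T ^^ k) x)) =
      (\<Sum>k\<le>degree p. a * coeff p k * \<psi> ((T ^^ k) x))"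
    by (simp add: coeff_eq_0)
  finally show ?thesis
    by (simp add: form_map_def right_diff_distrib sum_subtractf mult.assoc mult.left_commute)
qed

lemma form_map_real:
  fixes T :: "'a::real_vector \<Rightarrow> 'a"
  assumes "linear \<psi>"
  shows "form_map (map_poly complex_of_real p) T \<psi> x = \<psi> (poly_map p T x)"
  by (simp add: form_map_def poly_map_def linear_sum[OF assms] linear_scale[OF assms] scaleR_conv_of_real)

lemma form_map_eigen:
  assumes "\<And>x. x \<in> W \<Longrightarrow> T x \<in> W" "\<And>x. x \<in> W \<Longrightarrow> \<psi> (T x) = l * \<psi> x" "x \<in> W"
  shows "form_map p T \<psi> x = poly p l * \<psi> x"
proof -
  have "(T ^^ k) x \<in> W \<and> \<psi> ((T ^^ k) x) = l ^ k * \<psi> x" for k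
    by (induction k) (use assms in auto)
  then show ?thesis
    by (simp add: form_map_def poly_altdef sum_distrib_right mult.assoc)
qed

section \<open>Rational structures\<close>

definition rational_vector :: "'a::real_vector set \<Rightarrow> 'a \<Rightarrow> bool" where
  "rational_vector E x \<longleftrightarrow> (\<forall>b. representation E x b \<in> \<rat>)"

text \<open>Regard the reals as a rational vector space and extend \<open>1 \<mapsto> 1\<close>
  linearly.\<close>

lemma rational_projection:
  obtains \<pi> :: "real \<Rightarrow> rat"
  where "\<And>x y. \<pi> (x + y) = \<pi> x + \<pi> y" "\<And>q x. \<pi> (of_rat q * x) = q * \<pi> x" "\<pi> 1 = 1"
proof -
  interpret R: vector_space "\<lambda>(q::rat) (x::real). of_rat q * x"
    by unfold_locales (simp_all add: algebra_simps of_rat_add of_rat_mult)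
  interpret Q: vector_space "\<lambda>(q::rat) (x::rat). q * x"
    by unfold_locales (simp_all add: algebra_simps)
  interpret P: vector_space_pair "\<lambda>(q::rat) (x::real). of_rat q * x" "\<lambda>(q::rat) (x::rat). q * x" ..
  have "R.independent {1}" by simp
  from P.linear_independent_extend[OF this, of "\<lambda>_. 1"] obtain g
    where g: "Vector_Spaces.linear (\<lambda>(q::rat) (x::real). of_rat q * x) (\<lambda>(q::rat) (x::rat). q * x) g"
      "g 1 = 1" by auto
  interpret g: Vector_Spaces.linear "\<lambda>(q::rat) (x::real). of_rat q * x" "\<lambda>(q::rat) (x::rat). q * x" g
    by (rule g(1))
  show ?thesis using that[of g] g.add g.scale g(2) by blast
qed

locale rational_basis =
  fixes E :: "'a::real_vector set"
  assumes finite_basis: "finite E" and independent_basis: "independent E"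
    and span_basis: "span E = UNIV"
begin

lemma representation_sum_scale:
  "representation E (\<Sum>i\<in>I. c i *\<^sub>R v i) b = (\<Sum>i\<in>I. c i * representation E (v i) b)"
  using independent_basis span_basis
  by (simp add: representation_sum representation_scale)

lemma basis_expansion: "(\<Sum>b\<in>E. representation E x b *\<^sub>R b) = x"
  using independent_basis span_basis finite_basis by (intro sum_representation_eq) auto

lemma rational_vector_sum:
  assumes "\<And>i. i \<in> I \<Longrightarrow> c i \<in> \<rat>" "\<And>i. i \<in> I \<Longrightarrow> rational_vector E (v i)"
  shows "rational_vector E (\<Sum>i\<in>I. c i *\<^sub>R v i)"
  unfolding rational_vector_def representation_sum_scale
  using assms by (auto simp: rational_vector_def intro!: Rats_sum Rats_mult)

lemma rational_vector_basis: "b \<in> E \<Longrightarrow> rational_vector E b"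
  using independent_basis by (simp add: rational_vector_def representation_basis)

lemma rational_vector_linear:
  assumes f: "linear f" and E: "\<And>b. b \<in> E \<Longrightarrow> rational_vector E (f b)" and x: "rational_vector E x"
  shows "rational_vector E (f x)"
proof -
  have "f x = f (\<Sum>b\<in>E. representation E x b *\<^sub>R b)" by (simp add: basis_expansion)
  also have "\<dots> = (\<Sum>b\<in>E. representation E x b *\<^sub>R f b)"
    by (simp add: linear_sum[OF f] linear_scale[OF f])
  finally show ?thesis
    using x E by (auto simp: rational_vector_def[of E x] intro!: rational_vector_sum)
qed

text \<open>A rational-linear retraction of the reals onto the rationals turns real coordinates with
  respect to rational vectors into rational ones.\<close>

lemma rational_coordinates:
  assumes B: "\<And>b. b \<in> B \<Longrightarrow> rational_vector E b" and x: "rational_vector E x"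
    and eq: "x = (\<Sum>b\<in>B. \<rho> b *\<^sub>R b)"
  obtains r where "x = (\<Sum>b\<in>B. of_rat (r b) *\<^sub>R b)"
proof -
  obtain \<pi> :: "real \<Rightarrow> rat" where \<pi>: "\<And>x y. \<pi> (x + y) = \<pi> x + \<pi> y"
    "\<And>q x. \<pi> (of_rat q * x) = q * \<pi> x" "\<pi> 1 = 1"
    using rational_projection by blast
  have \<pi>0: "\<pi> 0 = 0" using \<pi>(2)[of 0] by simp
  have \<pi>_sum: "\<pi> (sum f I) = (\<Sum>i\<in>I. \<pi> (f i))" for f :: "'a \<Rightarrow> real" and I
    by (induction I rule: infinite_finite_induct) (simp_all add: \<pi> \<pi>0)
  have \<pi>_rat: "of_rat (\<pi> (y * z)) = of_rat (\<pi> y) * z" if "z \<in> \<rat>" for y z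
    using that \<pi>(2)[of _ y] by (elim Rats_cases) (simp add: mult.commute of_rat_mult)
  have coord: "representation E x e = (\<Sum>b\<in>B. of_rat (\<pi> (\<rho> b)) * representation E b e)" for e
  proof -
    \<comment> \<open>The factor 1 lets \<open>\<pi>_rat\<close> apply with \<open>y = 1\<close>,
      which shows that \<open>\<pi>\<close> fixes the rational coordinate.\<close>
    have "representation E x e = of_rat (\<pi> (1 * representation E x e))"
      using x by (subst \<pi>_rat) (simp_all add: rational_vector_def \<pi>)
    also have "1 * representation E x e = (\<Sum>b\<in>B. \<rho> b * representation E b e)"
      unfolding mult_1 eq by (rule representation_sum_scale)
    also have "of_rat (\<pi> \<dots>) = (\<Sum>b\<in>B. of_rat (\<pi> (\<rho> b * representation E b e)))"
      by (simp add: \<pi>_sum of_rat_sum)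
    also have "\<dots> = (\<Sum>b\<in>B. of_rat (\<pi> (\<rho> b)) * representation E b e)"
      by (intro sum.cong refl \<pi>_rat) (use B in \<open>auto simp: rational_vector_def\<close>)
    finally show ?thesis .
  qed
  have "x = (\<Sum>e\<in>E. representation E x e *\<^sub>R e)" by (simp add: basis_expansion)
  also have "\<dots> = (\<Sum>e\<in>E. \<Sum>b\<in>B. of_rat (\<pi> (\<rho> b)) *\<^sub>R representation E b e *\<^sub>R e)"
    by (simp add: coord scaleR_sum_left)
  also have "\<dots> = (\<Sum>b\<in>B. of_rat (\<pi> (\<rho> b)) *\<^sub>R (\<Sum>e\<in>E. representation E b e *\<^sub>R e))"
    by (subst sum.swap) (simp add: scaleR_sum_right)
  also have "\<dots> = (\<Sum>b\<in>B. of_rat (\<pi> (\<rho> b)) *\<^sub>R b)" by (simp add: basis_expansion)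
  finally show ?thesis by (rule that)
qed

end

section \<open>The lower central series\<close>

locale lie_alg =
  fixes br :: "'a::real_vector \<Rightarrow> 'a \<Rightarrow> 'a"
  assumes lie: "lie_algebra br"
begin

abbreviation "U \<equiv> lower_central br"

lemma linear_br: "linear (br x)" "linear (\<lambda>x. br x y)"
  using lie by (auto simp: lie_algebra_def)

lemma br_self: "br x x = 0" and
  jacobi: "br x (br y z) + br y (br z x) + br z (br x y) = 0"
  using lie by (auto simp: lie_algebra_def)

lemma br_anti: "br y x = - br x y"
proof -
  have "br (x + y) (x + y) = br x x + br x y + (br y x + br y y)"
    by (simp add: linear_add[OF linear_br(1)] linear_add[OF linear_br(2)])
  then show ?thesis by (simp add: br_self eq_neg_iff_add_eq_0 add.commute)
qed

lemma subspace_U: "subspace (U j)"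
  by (cases j) (simp_all add: subspace_UNIV)

lemma br_U: "y \<in> U j \<Longrightarrow> br x y \<in> U (Suc j)"
  by (auto intro: span_base)

lemma U_Suc_subset: "U (Suc j) \<subseteq> U j"
proof (induction j)
  case (Suc j)
  have "{br x y |x y. y \<in> U (Suc j)} \<subseteq> {br x y |x y. y \<in> U j}" using Suc by blast
  then show ?case unfolding lower_central.simps by (rule span_mono)
qed simp

text \<open>By Jacobi, bracketing with \<open>br a b\<close> is the commutator of bracketing with
  \<open>a\<close> and with \<open>b\<close>, and each of these raises the index by one. Hence, for
  \<open>y\<close> in \<open>U j\<close>, \<open>br x y\<close> modulo
  \<open>U (Suc (Suc j))\<close> sees \<open>x\<close> only in the abelianization.\<close>

lemma br_U_Suc_0: 
  assumes "x \<in> U (Suc 0)" "y \<in> U j"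
  shows "br x y \<in> U (Suc (Suc j))"
proof -
  have "x \<in> span {br x y |x y. y \<in> (UNIV :: 'a set)}" using assms(1) by simp
  then show ?thesis
  proof (induction rule: span_induct)
    case base
    show ?case
      by (simp add: subspace_def linear_0[OF linear_br(2)] linear_add[OF linear_br(2)] 
          linear_scale[OF linear_br(2)] span_zero span_add span_scale)
  next
    case (step z)
    then obtain a b where z: "z = br a b" by blast
    have "br z y = br a (br b y) - br b (br a y)"
      using jacobi[of a b y] br_anti[of y a] br_anti[of y "br a b"] linear_neg[OF linear_br(1)]
      by (simp add: z eq_neg_iff_add_eq_0 algebra_simps)
    also have "\<dots> \<in> U (Suc (Suc j))"
      by (intro subspace_diff subspace_U br_U assms)
    finally show ?case .
  qed
qed

end

locale lie_auto = lie_alg +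
  fixes T :: "'a \<Rightarrow> 'a"
  assumes auto: "lie_automorphism br T"
begin

lemma linear_T: "linear T" and T_br: "T (br x y) = br (T x) (T y)" and bij_T: "bij T"
  using auto by (auto simp: lie_automorphism_def lie_hom_def)

lemma T_U: "x \<in> U j \<Longrightarrow> T x \<in> U j"
proof (induction j arbitrary: x)
  case (Suc j)
  have "x \<in> span {br x y |x y. y \<in> U j}" using Suc.prems by simp
  then show ?case
  proof (induction rule: span_induct)
    case base
    show ?case
      by (simp add: subspace_def linear_0[OF linear_T] linear_add[OF linear_T] 
          linear_scale[OF linear_T] span_zero span_add span_scale)
  next
    case (step z)
    then obtain a b where z: "z = br a b" "b \<in> U j" by blast
    show ?case unfolding z T_br by (intro br_U Suc.IH z)
  qed
qed simp

end

section \<open>Eigenvalues on the quotients of the lower central series\<close>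

abbreviation rpoly :: "rat poly \<Rightarrow> real poly" where
  "rpoly \<equiv> map_poly of_rat"

lemma of_real_of_rat: "complex_of_real (of_rat q) = of_rat q"
  by (induction q) (simp add: of_rat_rat)

lemma cpoly_conv_rpoly: "map_poly complex_of_real (rpoly p) = cpoly p"
  by (simp add: map_poly_map_poly o_def of_real_of_rat)

text \<open>Extend a rational basis of \<open>U\<close> to a rational basis of \<open>W\<close>. In
  it \<open>T\<close> has rational coordinates, and \<open>q\<close> is the characteristic
  polynomial of the block on the added vectors. The spanning sets \<open>SU\<close> and
  \<open>SW\<close> are where rational basis vectors are taken from.\<close>

lemma (in rational_basis) quotient_char_poly:
  fixes T :: "'a \<Rightarrow> 'a"
  assumes T: "linear T" "\<And>x. rational_vector E x \<Longrightarrow> rational_vector E (T x)"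
    and S: "U = span SU" "W = span SW" "U \<subseteq> W"
      "\<And>x. x \<in> SU \<Longrightarrow> rational_vector E x" "\<And>x. x \<in> SW \<Longrightarrow> rational_vector E x"
    and inv: "\<And>x. x \<in> U \<Longrightarrow> T x \<in> U" "\<And>x. x \<in> W \<Longrightarrow> T x \<in> W"
  obtains q where "lead_coeff q = 1" "degree q = dim W - dim U"
    "\<And>x. x \<in> W \<Longrightarrow> poly_map (rpoly q) T x \<in> U"
    "\<And>l. l \<in> roots q \<Longrightarrow> \<exists>\<phi>. linear \<phi> \<and> (\<forall>x\<in>U. \<phi> x = 0) \<and> (\<exists>x\<in>W. \<phi> x \<noteq> 0) \<and>
      (\<forall>x\<in>W. \<phi> (T x) = l * \<phi> x)"
proof -
  have subU: "subspace U" and subW: "subspace W" using S by simp_all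
  obtain BU where BU: "BU \<subseteq> SU" "independent BU" "SU \<subseteq> span BU"
    using maximal_independent_subset by blast
  obtain B where B: "BU \<subseteq> B" "B \<subseteq> BU \<union> SW" "independent B" "BU \<union> SW \<subseteq> span B"
    using maximal_independent_subset_extend[of BU "BU \<union> SW"] BU(2) by blast
  have spanU: "span BU = U"
    using BU S(1) by (metis span_mono span_span subset_antisym)
  have spanW: "span B = W"
  proof
    have "BU \<subseteq> W" using BU(1) S span_superset by blast
    then have "B \<subseteq> W" using B(2) S(2) span_superset by blast
    then show "span B \<subseteq> W" using subW by (simp add: span_minimal)
    show "W \<subseteq> span B" using B(4) S(2) by (metis Un_subset_iff span_mono span_span)
  qed
  have finB: "finite B" 
    using independent_span_bound[OF finite_basis B(3)] span_basis by auto
  have ratB: "\<And>b. b \<in> B \<Longrightarrow> rational_vector E b" using B(2) BU(1) S by blast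
  define C where "C = B - BU"
  define n where "n = card C"
  have finC: "finite C" using finB by (simp add: C_def)
  have "dim W = card B" "dim U = card BU"
    using spanW spanU B(3) BU(2) by (metis dim_span_eq_card_independent)+
  then have n: "n = dim W - dim U"
    using B(1) finB by (simp add: n_def C_def card_Diff_subset finite_subset)
  obtain c where c: "bij_betw c {..<n} C"
    using ex_bij_betw_nat_finite[OF finC] by (auto simp: n_def atLeast0LessThan)
  have cB: "c j \<in> B" "c j \<in> C" if "j < n" for j
    using bij_betwE[OF c] that by (auto simp: C_def)
  have "\<exists>r::'a \<Rightarrow> rat. T (c j) = (\<Sum>b\<in>B. of_rat (r b) *\<^sub>R b)" if j: "j < n" for j
  proof -
    have "c j \<in> W" using cB(1)[OF j] spanW span_base by blast
    then have "T (c j) \<in> span B" using inv(2) spanW by simp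
    then obtain \<rho> where "T (c j) = (\<Sum>b\<in>B. \<rho> b *\<^sub>R b)"
      using finB by (auto simp: span_finite)
    from rational_coordinates[OF ratB _ this] show ?thesis
      using T(2) ratB cB(1)[OF j] by blast
  qed
  then obtain r :: "nat \<Rightarrow> 'a \<Rightarrow> rat"
    where r: "\<And>j. j < n \<Longrightarrow> T (c j) = (\<Sum>b\<in>B. of_rat (r j b) *\<^sub>R b)" by metis
  \<comment> \<open>Only the coordinates along the complement \<open>C\<close> are kept; the rest
    lies in \<open>U\<close>.\<close>
  define A where "A = mat n n (\<lambda>(i, j). r j (c i))"
  have A: "A \<in> carrier_mat n n" by (simp add: A_def)
  have Tc: "T (c j) - (\<Sum>i<n. of_rat (A $$ (i, j)) *\<^sub>R c i) \<in> U" if j: "j < n" for j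
  proof -
    have "(\<Sum>b\<in>B. of_rat (r j b) *\<^sub>R b) = (\<Sum>b\<in>C. of_rat (r j b) *\<^sub>R b) + (\<Sum>b\<in>BU. of_rat (r j b) *\<^sub>R b)"
      unfolding C_def by (rule sum.subset_diff[OF B(1) finB])
    moreover have "(\<Sum>b\<in>C. of_rat (r j b) *\<^sub>R b) = (\<Sum>i<n. of_rat (A $$ (i, j)) *\<^sub>R c i)"
      using j by (subst sum.reindex_bij_betw[OF c, symmetric]) (simp add: A_def)
    moreover have "(\<Sum>b\<in>BU. of_rat (r j b) *\<^sub>R b) \<in> U"
      unfolding spanU[symmetric] by (intro span_sum span_scale span_base)
    ultimately show ?thesis using r[OF j] by simp
  qed
  define q where "q = char_poly A"
  have q: "degree q = n" "lead_coeff q = 1"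
    using degree_monic_char_poly[OF A] by (simp_all add: q_def)
  show ?thesis
  proof (rule that[of q])
    show "lead_coeff q = 1" "degree q = dim W - dim U" using q n by simp_all
    fix x assume x: "x \<in> W"
    have A': "map_mat of_rat A \<in> carrier_mat n n" using A by simp
    have q': "rpoly q = char_poly (map_mat of_rat A)"
      unfolding q_def by (rule of_rat_hom.char_poly_hom[OF A, symmetric])
    have gen: "poly_map (rpoly q) T b \<in> U" if b: "b \<in> B" for b
    proof (cases "b \<in> BU")
      case True
      then have "b \<in> U" using spanU span_base by blast
      then show ?thesis by (intro poly_map_mem subU inv(1))
    next
      case False
      then obtain k where k: "k < n" "b = c k"
        using b c by (auto simp: C_def bij_betw_def)
      show ?thesis unfolding q' k(2)
        by (rule char_poly_map_mem[OF T(1) subU inv(1) A' _ k(1)]) (use Tc A in auto)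
    qed
    have "x \<in> span B" using x spanW by simp
    then show "poly_map (rpoly q) T x \<in> U"
    proof (induction rule: span_induct)
      case base
      show ?case using subU poly_map_linear[OF T(1)]
        by (simp add: subspace_def linear_0 linear_add linear_scale)
    qed (rule gen)
  next
    fix l assume l: "l \<in> roots q"
    define AC where "AC = map_mat complex_of_rat A"
    have AC: "AC \<in> carrier_mat n n" using A by (simp add: AC_def)
    \<comment> \<open>A functional is a row vector, so its values on the \<open>c j\<close> come
      from an eigenvector of the transpose; on \<open>BU\<close> it is set to 0.\<close>
    have "cpoly q = char_poly (transpose_mat AC)"
      unfolding q_def AC_def char_poly_transpose_mat[OF AC[unfolded AC_def]]
      by (rule of_rat_hom.char_poly_hom[OF A, symmetric])
    then have "eigenvalue (transpose_mat AC) l"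
      using l eigenvalue_root_char_poly[of "transpose_mat AC" n] AC by (simp add: roots_def)
    then obtain w where w: "w \<in> carrier_vec n" "w \<noteq> 0\<^sub>v n" "transpose_mat AC *\<^sub>v w = l \<cdot>\<^sub>v w"
      using AC by (auto simp: eigenvalue_def eigenvector_def)
    have wj: "(\<Sum>i<n. of_rat (A $$ (i, j)) * w $ i) = l * w $ j" if j: "j < n" for j
    proof -
      have "(\<Sum>i<n. of_rat (A $$ (i, j)) * w $ i) = (\<Sum>i<n. AC $$ (i, j) * w $ i)"
        using A j by (intro sum.cong) (simp_all add: AC_def)
      also have "\<dots> = (transpose_mat AC *\<^sub>v w) $ j"
        using AC w(1) j by (simp add: scalar_prod_def atLeast0LessThan)
      also have "\<dots> = l * w $ j" using w(1) j by (simp add: w(3))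
      finally show ?thesis .
    qed
    define f where "f b = (if b \<in> C then w $ (inv_into {..<n} c b) else 0)" for b
    obtain \<phi> where \<phi>: "linear \<phi>" "\<And>b. b \<in> B \<Longrightarrow> \<phi> b = f b"
      using linear_independent_extend[OF B(3), of f] by blast
    have \<phi>c: "\<phi> (c j) = w $ j" if "j < n" for j
      using that cB[OF that] c by (simp add: \<phi>(2) f_def bij_betw_def)
    have \<phi>U: "\<phi> x = 0" if "x \<in> U" for x
    proof (rule linear_eq_0_on_span[OF \<phi>(1)])
      show "x \<in> span BU" using that spanU by simp
      show "\<phi> b = 0" if "b \<in> BU" for b using that B(1) \<phi>(2) by (auto simp: f_def C_def)
    qed
    have "\<phi> (T x) = l * \<phi> x" if "x \<in> W" for x
    proof (rule linear_eq_on_span[of "\<lambda>x. \<phi> (T x)" "\<lambda>x. l * \<phi> x" B])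
      show "linear (\<lambda>x. \<phi> (T x))"
        by (rule linearI) (simp_all add: linear_add[OF T(1)] linear_scale[OF T(1)]
            linear_add[OF \<phi>(1)] linear_scale[OF \<phi>(1)])
      show "linear (\<lambda>x. l * \<phi> x)"
        by (rule linearI) (simp_all add: linear_add[OF \<phi>(1)] linear_scale[OF \<phi>(1)] distrib_left)
      show "x \<in> span B" using that spanW by simp
      fix b assume b: "b \<in> B"
      show "\<phi> (T b) = l * \<phi> b"
      proof (cases "b \<in> BU")
        case True
        then have "b \<in> U" using spanU span_base by blast
        then show ?thesis using \<phi>U inv(1) by simp
      next
        case False
        then obtain k where k: "k < n" "b = c k"
          using b c by (auto simp: C_def bij_betw_def)
        have "\<phi> (T b) = \<phi> (T (c k) - (\<Sum>i<n. of_rat (A $$ (i, k)) *\<^sub>R c i)) +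
            \<phi> (\<Sum>i<n. of_rat (A $$ (i, k)) *\<^sub>R c i)"
          by (simp add: k(2) linear_diff[OF \<phi>(1)])
        also have "\<dots> = (\<Sum>i<n. of_rat (A $$ (i, k)) * w $ i)"
          using \<phi>U[OF Tc[OF k(1)]] \<phi>c
          by (simp add: linear_sum[OF \<phi>(1)] linear_scale[OF \<phi>(1)] scaleR_conv_of_real of_real_of_rat)
        finally show ?thesis using wj[OF k(1)] \<phi>c[OF k(1)] k(2) by simp
      qed
    qed
    moreover obtain j where "j < n" "w $ j \<noteq> 0" using w(1,2) by (metis carrier_vecD eq_vecI index_zero_vec)
    then have "c j \<in> W" "\<phi> (c j) \<noteq> 0" using \<phi>c cB(1) spanW span_base by auto
    ultimately show "\<exists>\<phi>. linear \<phi> \<and> (\<forall>x\<in>U. \<phi> x = 0) \<and> (\<exists>x\<in>W. \<phi> x \<noteq> 0) \<and> (\<forall>x\<in>W. \<phi> (T x) = l * \<phi> x)"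
      using \<phi>(1) \<phi>U by blast
  qed
qed

context lie_auto
begin

text \<open>An eigenvector of the transpose of \<open>T\<close> on \<open>U j / U (Suc j)\<close>, which avoids quotient spaces.\<close>

definition lcs_eigenvalue :: "nat \<Rightarrow> complex \<Rightarrow> bool" where
  "lcs_eigenvalue j l \<longleftrightarrow> (\<exists>\<phi>. linear \<phi> \<and> (\<forall>x\<in>U (Suc j). \<phi> x = 0) \<and> (\<exists>x\<in>U j. \<phi> x \<noteq> 0) \<and>
     (\<forall>x\<in>U j. \<phi> (T x) = l * \<phi> x))"

text \<open>The eigenfunctional sends \<open>P(T) x\<close> to \<open>P(l)\<close> times its value
  at \<open>x\<close>, and it vanishes where \<open>P(T) x\<close> lies.\<close>

lemma lcs_eigenvalue_root:
  assumes "lcs_eigenvalue j l" and "\<And>x. x \<in> U j \<Longrightarrow> poly_map (rpoly P) T x \<in> U (Suc j)"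
  shows "l \<in> roots P"
proof -
  obtain \<phi> x where \<phi>: "linear \<phi>" "\<forall>x\<in>U (Suc j). \<phi> x = 0" "x \<in> U j" "\<phi> x \<noteq> 0"
    "\<forall>x\<in>U j. \<phi> (T x) = l * \<phi> x"
    using assms(1) unfolding lcs_eigenvalue_def by blast
  have "poly (cpoly P) l * \<phi> x = form_map (cpoly P) T \<phi> x"
    using form_map_eigen[of "U j" T \<phi> l x "cpoly P"] T_U \<phi> by simp
  also have "\<dots> = \<phi> (poly_map (rpoly P) T x)"
    using form_map_real[OF \<phi>(1)] by (simp add: cpoly_conv_rpoly[symmetric])
  also have "\<dots> = 0" using assms(2) \<phi>(2,3) by simp
  finally show ?thesis using \<phi>(4) by (simp add: roots_def)
qed

end

text \<open>Apply the linear factors in turn. As the full product annihilates the form, some factor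
  is the first to annihilate it, and the form just before is an eigenform for that factor.
  \<open>good\<close> stands for any property that survives each factor.\<close>

lemma common_eigenform:
  fixes \<gamma> :: "'a \<Rightarrow> 'b \<Rightarrow> complex"
  assumes closed: "\<And>\<gamma> a. good \<gamma> \<Longrightarrow> good (\<lambda>x y. \<gamma> (T x) y - a * \<gamma> x y)"
    and "good \<gamma>" "y \<in> W" "\<gamma> x y \<noteq> 0"
    and "\<And>x y. y \<in> W \<Longrightarrow> form_map (\<Prod>a\<in>#A. [:- a, 1:]) T (\<lambda>x. \<gamma> x y) x = 0"
  shows "\<exists>a \<gamma>' x y. a \<in># A \<and> good \<gamma>' \<and> y \<in> W \<and> \<gamma>' x y \<noteq> 0 \<and> (\<forall>x. \<forall>y\<in>W. \<gamma>' (T x) y = a * \<gamma>' x y)"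
  using assms(2-)
proof (induction A arbitrary: \<gamma> x y)
  case empty
  then show ?case by (simp add: form_map_def)
next
  case (add a A)
  define \<gamma>' where "\<gamma>' x y = \<gamma> (T x) y - a * \<gamma> x y" for x y
  show ?case
  proof (cases "\<forall>x. \<forall>y\<in>W. \<gamma>' x y = 0")
    case True
    then have "\<forall>x. \<forall>y\<in>W. \<gamma> (T x) y = a * \<gamma> x y" by (simp add: \<gamma>'_def)
    then show ?thesis using add.prems by (meson union_single_eq_member)
  next
    case False
    then obtain x y where xy: "y \<in> W" "\<gamma>' x y \<noteq> 0" by blast
    have "good \<gamma>'" using closed add.prems(1) by (simp add: \<gamma>'_def[abs_def])
    moreover have "form_map (\<Prod>a\<in>#A. [:- a, 1:]) T (\<lambda>x. \<gamma>' x y) x = 0" if "y \<in> W" for x y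
    proof -
      have "(\<Prod>a\<in>#A. [:- a, 1:]) \<noteq> 0" by (auto simp: prod_mset_zero_iff)
      from form_map_linear_factor[OF this, of a T "\<lambda>x. \<gamma> x y" x]
      show ?thesis using add.prems(4)[OF that] by (simp add: \<gamma>'_def del: mult_pCons_left)
    qed
    ultimately obtain a' \<gamma>'' x' y' where "a' \<in># A" "good \<gamma>''" "y' \<in> W" "\<gamma>'' x' y' \<noteq> 0"
      "\<forall>x. \<forall>y\<in>W. \<gamma>'' (T x) y = a' * \<gamma>'' x y"
      using add.IH[where \<gamma> = \<gamma>' and x = x and y = y, OF _ xy] by blast
    then show ?thesis
      by (intro exI[of _ a'] exI[of _ \<gamma>''] exI[of _ x'] exI[of _ y']) simp
  qed
qed

context lie_auto
begin

text \<open>A functional on \<open>U (Suc j)\<close> pulls back along the bracket to a form on the abelianization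
  tensor \<open>U j\<close>, on which \<open>T \<otimes> T\<close> acts by \<open>l\<close>; an eigenform for the action of \<open>T \<otimes> 1\<close> splits \<open>l\<close>.\<close>

lemma lcs_eigenvalue_descent:
  assumes P: "P \<noteq> 0" "\<And>x. poly_map (rpoly P) T x \<in> U (Suc 0)" and l: "lcs_eigenvalue (Suc j) l"
  obtains a where "a \<in> roots P" "a \<noteq> 0" "lcs_eigenvalue j (l / a)"
proof -
  obtain \<phi> where \<phi>: "linear \<phi>" "\<forall>x\<in>U (Suc (Suc j)). \<phi> x = 0" "\<exists>x\<in>U (Suc j). \<phi> x \<noteq> 0"
    "\<forall>x\<in>U (Suc j). \<phi> (T x) = l * \<phi> x"
    using l unfolding lcs_eigenvalue_def by blast
  \<comment> \<open>Linearity is recorded only in the second argument, since the first is frozen at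
    the end to obtain a functional on \<open>U j\<close>.\<close>
  define good where "good \<gamma> \<longleftrightarrow> (\<forall>x. linear (\<gamma> x)) \<and> (\<forall>x. \<forall>y\<in>U (Suc j). \<gamma> x y = 0) \<and>
    (\<forall>x. \<forall>y\<in>U j. \<gamma> (T x) (T y) = l * \<gamma> x y)" for \<gamma> :: "'a \<Rightarrow> 'a \<Rightarrow> complex"
  define \<gamma> where "\<gamma> x y = \<phi> (br x y)" for x y
  have lin: "linear (\<gamma> x)" "linear (\<lambda>x. \<gamma> x y)" for x y
    unfolding \<gamma>_def
    by (rule linearI; simp add: linear_add[OF linear_br(1)] linear_scale[OF linear_br(1)]
        linear_add[OF linear_br(2)] linear_scale[OF linear_br(2)]
        linear_add[OF \<phi>(1)] linear_scale[OF \<phi>(1)])+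
  have good: "good \<gamma>"
    unfolding good_def using lin(1) \<phi>(2,4) br_U
    by (simp add: \<gamma>_def del: lower_central.simps flip: T_br)
  have closed: "good (\<lambda>x y. \<gamma> (T x) y - a * \<gamma> x y)" if "good \<gamma>" for \<gamma> a
    using that unfolding good_def
    by (auto simp: algebra_simps intro!: linearI simp: linear_add linear_scale scaleR_conv_of_real)
  obtain A where A: "cpoly P = Polynomial.smult (lead_coeff (cpoly P)) (\<Prod>a\<in>#A. [:- a, 1:])"
    using alg_closed_imp_factorization[of "cpoly P"] P(1) by auto
  have "\<exists>x. \<exists>y\<in>U j. \<gamma> x y \<noteq> 0"
  proof (rule ccontr)
    assume "\<not> (\<exists>x. \<exists>y\<in>U j. \<gamma> x y \<noteq> 0)"
    then have *: "\<phi> z = 0" if "z \<in> {br x y |x y. y \<in> U j}" for z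
      using that by (auto simp: \<gamma>_def)
    have "\<phi> z = 0" if "z \<in> U (Suc j)" for z
      using linear_eq_0_on_span[OF \<phi>(1), of "{br x y |x y. y \<in> U j}" z] * that by simp
    then show False using \<phi>(3) by blast
  qed
  then obtain x y where xy: "y \<in> U j" "\<gamma> x y \<noteq> 0" by blast
  have kill: "form_map (\<Prod>a\<in>#A. [:- a, 1:]) T (\<lambda>x. \<gamma> x y) x = 0" if y: "y \<in> U j" for x y
  proof -
    have "form_map (cpoly P) T (\<lambda>x. \<gamma> x y) x = \<gamma> (poly_map (rpoly P) T x) y"
      using form_map_real[OF lin(2)] by (simp add: cpoly_conv_rpoly[symmetric])
    \<comment> \<open>\<open>P(T) x\<close> is in \<open>U (Suc 0)\<close>, so its bracket with
      \<open>y\<close> falls two steps, into the kernel of \<open>\<phi>\<close>.\<close>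
    also have "\<dots> = 0"
      using br_U_Suc_0[OF P(2) y] \<phi>(2) by (simp add: \<gamma>_def)
    finally have "form_map (Polynomial.smult (lead_coeff (cpoly P)) (\<Prod>a\<in>#A. [:- a, 1:])) T (\<lambda>x. \<gamma> x y) x = 0"
      using A by metis
    moreover have "form_map (Polynomial.smult s p) T \<psi> x = s * form_map p T \<psi> x" if "s \<noteq> 0" for s p \<psi>
      using that by (simp add: form_map_def sum_distrib_left mult.assoc)
    ultimately show ?thesis using P(1) by simp
  qed
  obtain a \<gamma>' x y where a: "a \<in># A" and \<gamma>': "good \<gamma>'" "y \<in> U j" "\<gamma>' x y \<noteq> 0"
    "\<forall>x. \<forall>y\<in>U j. \<gamma>' (T x) y = a * \<gamma>' x y"
    using common_eigenform[of good T \<gamma> y "U j" x A, OF closed good xy kill] by blast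
  have "poly (cpoly P) a = 0"
    by (subst A) (use a in \<open>auto simp: poly_prod_mset\<close>)
  then have "a \<in> roots P" by (simp add: roots_def)
  \<comment> \<open>For \<open>a = 0\<close> the form would vanish at every \<open>T x\<close>,
    hence everywhere because \<open>T\<close> is onto.\<close>
  moreover have a0: "a \<noteq> 0"
    using \<gamma>' bij_T by (metis bij_pointE mult_zero_left)
  moreover have "lcs_eigenvalue j (l / a)"
    unfolding lcs_eigenvalue_def
  proof (intro exI conjI)
    show "linear (\<gamma>' x)" "\<forall>y\<in>U (Suc j). \<gamma>' x y = 0" "\<exists>y\<in>U j. \<gamma>' x y \<noteq> 0"
      using \<gamma>' by (auto simp: good_def)
    show "\<forall>y\<in>U j. \<gamma>' x (T y) = l / a * \<gamma>' x y"
    proof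
      fix y assume y: "y \<in> U j"
      \<comment> \<open>Both sides equal \<open>\<gamma>' (T x) (T y)\<close>, evaluated with
        \<open>T \<otimes> 1\<close> first and with \<open>T \<otimes> T\<close>.\<close>
      have "a * \<gamma>' x (T y) = l * \<gamma>' x y"
        using \<gamma>'(1,4) T_U[OF y] y unfolding good_def by metis
      then show "\<gamma>' x (T y) = l / a * \<gamma>' x y" using a0 by (simp add: field_simps)
    qed
  qed
  ultimately show ?thesis by (rule that)
qed

text \<open>Each descent step splits off one root; at \<open>U 0\<close> the remaining eigenvalue is
  itself a root, so \<open>Suc j\<close> factors arise.\<close>

lemma lcs_eigenvalue_prod:
  assumes P: "P \<noteq> 0" "\<And>x. poly_map (rpoly P) T x \<in> U (Suc 0)"
  shows "lcs_eigenvalue j l \<Longrightarrow> \<exists>\<alpha>. (\<forall>k<Suc j. \<alpha> k \<in> roots P) \<and> l = (\<Prod>k<Suc j. \<alpha> k)"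
proof (induction j arbitrary: l)
  case 0
  then have "l \<in> roots P" by (rule lcs_eigenvalue_root) (rule P(2))
  then show ?case by (intro exI[of _ "\<lambda>_. l"]) simp
next
  case (Suc j)
  obtain a where a: "a \<in> roots P" "a \<noteq> 0" "lcs_eigenvalue j (l / a)"
    using lcs_eigenvalue_descent[OF P Suc.prems] by blast
  from Suc.IH[OF a(3)] obtain \<alpha> where \<alpha>: "\<forall>k<Suc j. \<alpha> k \<in> roots P" "l / a = (\<Prod>k<Suc j. \<alpha> k)" by blast
  let ?\<beta> = "\<alpha>(Suc j := a)"
  have "(\<Prod>k<Suc j. ?\<beta> k) = (\<Prod>k<Suc j. \<alpha> k)" by (intro prod.cong) auto
  then have "(\<Prod>k<Suc (Suc j). ?\<beta> k) = l / a * a"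
    unfolding \<alpha>(2) by (subst prod.lessThan_Suc) simp
  with \<alpha>(1) a show ?case by (intro exI[of _ ?\<beta>]) (auto simp: less_Suc_eq)
qed

end

section \<open>Anosov automorphisms\<close>

lemma abs_coeff_0_char_poly:
  fixes A :: "int mat"
  assumes A: "A \<in> carrier_mat n n" and "det A \<in> {1, - 1}"
  shows "\<bar>coeff (char_poly A) 0\<bar> = 1"
proof -
  have "poly (char_poly A) 0 = det (- A)"
    unfolding char_poly_def
    by (rule poly_det_cong[of _ n]) (use A in \<open>auto simp: char_poly_matrix_def\<close>)
  also have "- A = (- 1) \<cdot>\<^sub>m A" using A by auto
  finally have "coeff (char_poly A) 0 = (- 1) ^ n * det A"
    using A by (simp add: poly_0_coeff_0)
  with assms(2) show ?thesis by (auto simp: abs_mult)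
qed

lemma rpoly_of_int: "rpoly (map_poly of_int p) = map_poly real_of_int p"
  by (simp add: map_poly_map_poly o_def)

lemma cpoly_of_int: "cpoly (map_poly of_int p) = map_poly of_int p"
  by (simp add: map_poly_map_poly o_def)

locale anosov_auto = lie_auto +
  fixes e :: "nat \<Rightarrow> 'a" and d :: nat and M :: "int mat"
  assumes hyperbolic: "complex_eigenvalue T l \<Longrightarrow> cmod l \<noteq> 1"
    and basis: "ordered_basis e d UNIV"
    and rational: "rational_structure_constants br e d"
    and matrix: "matrix_of_map T e d (map_mat real_of_int M)"
    and unimodular: "det M \<in> {1, - 1}"
begin

lemma M_carrier: "M \<in> carrier_mat d d"
  and T_e: "j < d \<Longrightarrow> T (e j) = (\<Sum>i<d. real_of_int (M $$ (i, j)) *\<^sub>R e i)"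
  using matrix by (auto simp: matrix_of_map_def)

sublocale rational_basis "e ` {..<d}"
  using basis by unfold_locales (auto simp: ordered_basis_def)

abbreviation "rational_vec \<equiv> rational_vector (e ` {..<d})"

lemma rational_e: "i < d \<Longrightarrow> rational_vec (e i)"
  by (rule rational_vector_basis) simp

lemma rational_T: "rational_vec x \<Longrightarrow> rational_vec (T x)"
  by (erule rational_vector_linear[OF linear_T, rotated])
    (auto simp: T_e intro!: rational_vector_sum rational_e)

lemma rational_br:
  assumes "rational_vec x" "rational_vec y"
  shows "rational_vec (br x y)"
proof (rule rational_vector_linear[OF linear_br(2) _ assms(1)], safe)
  fix i assume i: "i < d"
  show "rational_vec (br (e i) y)"
  proof (rule rational_vector_linear[OF linear_br(1) _ assms(2)], safe)
    fix j assume j: "j < d"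
    obtain c where "\<forall>k<d. c k \<in> \<rat>" "br (e i) (e j) = (\<Sum>k<d. c k *\<^sub>R e k)"
      using rational i j unfolding rational_structure_constants_def by blast
    then show "rational_vec (br (e i) (e j))"
      by (auto intro!: rational_vector_sum rational_e)
  qed
qed

text \<open>Rational structure constants keep brackets of rational vectors rational, and by
  bilinearity brackets of spanning vectors span. This feeds
  \<open>quotient_char_poly\<close>.\<close>

lemma rational_U: "\<exists>S. (\<forall>x\<in>S. rational_vec x) \<and> U j = span S"
proof (induction j)
  case 0
  show ?case
    by (rule exI[of _ "e ` {..<d}"]) (use span_basis rational_e in auto)
next
  case (Suc j)
  then obtain S where S: "\<forall>x\<in>S. rational_vec x" "U j = span S" by blast
  let ?S = "{br x y |x y. x \<in> e ` {..<d} \<and> y \<in> S}"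
  have 1: "br x y \<in> span ?S" if x: "x \<in> e ` {..<d}" and y: "y \<in> span S" for x y
    using y
  proof (induction rule: span_induct)
    case base
    show ?case
      by (simp add: subspace_def linear_0[OF linear_br(1)] linear_add[OF linear_br(1)]
          linear_scale[OF linear_br(1)] span_zero span_add span_scale)
  next
    case (step z)
    with x show ?case by (auto intro!: span_base)
  qed
  have 2: "br x y \<in> span ?S" if y: "y \<in> span S" for x y
  proof -
    have "x \<in> span (e ` {..<d})" using span_basis by simp
    then show ?thesis
    proof (induction rule: span_induct)
      case base
      show ?case
        by (simp add: subspace_def linear_0[OF linear_br(2)] linear_add[OF linear_br(2)]
            linear_scale[OF linear_br(2)] span_zero span_add span_scale)
    qed (rule 1[OF _ y])
  qed
  have "U (Suc j) = span ?S"
  proof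
    show "U (Suc j) \<subseteq> span ?S"
      unfolding lower_central.simps by (rule span_minimal) (use 2 S(2) in auto)
    show "span ?S \<subseteq> U (Suc j)"
      unfolding lower_central.simps by (rule span_mono) (use S(2) span_base in blast)
  qed
  moreover have "\<forall>x\<in>?S. rational_vec x" using S(1) rational_e rational_br by auto
  ultimately show ?case by blast
qed

section \<open>From eigenvalues on quotients to eigenvalues on the whole algebra\<close>

lemma poly_map_char_poly_M: "poly_map (rpoly (map_poly of_int (char_poly M))) T x = 0"
proof -
  have M': "map_mat real_of_int M \<in> carrier_mat d d" using M_carrier by simp
  have eq: "rpoly (map_poly of_int (char_poly M)) = char_poly (map_mat real_of_int M)"
    unfolding rpoly_of_int by (rule of_int_hom.char_poly_hom[OF M_carrier, symmetric])
  have "poly_map (char_poly (map_mat real_of_int M)) T (e k) \<in> {0}" if "k < d" for k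
    by (rule char_poly_map_mem[OF linear_T _ _ M' _ that])
      (use M_carrier in \<open>auto simp: T_e linear_0[OF linear_T]\<close>)
  then have "poly_map (rpoly (map_poly of_int (char_poly M))) T b = 0" if "b \<in> e ` {..<d}" for b
    using that by (auto simp: eq)
  with linear_eq_0_on_span[OF poly_map_linear[OF linear_T], of "e ` {..<d}" _ x]
  show ?thesis using span_basis by simp
qed

text \<open>\<open>char_poly M\<close> annihilates \<open>T\<close> on the whole algebra, hence on
  every quotient. Hyperbolicity and integrality both reach the quotients this way.\<close>

lemma lcs_eigenvalue_char_poly_M:
  assumes "lcs_eigenvalue j l"
  shows "l \<in> roots (map_poly of_int (char_poly M))"
  by (rule lcs_eigenvalue_root[OF assms])
    (simp add: poly_map_char_poly_M subspace_0[OF subspace_U] del: lower_central.simps)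

text \<open>The real and imaginary parts of a complex eigenvector of \<open>M\<close> are the
  coordinates of the required pair; independence of the basis makes the pair nonzero.\<close>

lemma complex_eigenvalue_root:
  assumes "l \<in> roots (map_poly of_int (char_poly M))"
  shows "complex_eigenvalue T l"
proof -
  have M': "map_mat complex_of_int M \<in> carrier_mat d d" using M_carrier by simp
  have "poly (char_poly (map_mat complex_of_int M)) l = 0"
    using assms of_int_hom.char_poly_hom[OF M_carrier, where 'a = complex]
    by (simp add: roots_def cpoly_of_int)
  then have "eigenvalue (map_mat complex_of_int M) l"
    using eigenvalue_root_char_poly[OF M'] by simp
  then obtain v where v: "v \<in> carrier_vec d" "v \<noteq> 0\<^sub>v d" "map_mat complex_of_int M *\<^sub>v v = l \<cdot>\<^sub>v v"
    using M_carrier by (auto simp: eigenvalue_def eigenvector_def)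
  have vi: "(\<Sum>j<d. of_int (M $$ (i, j)) * v $ j) = l * v $ i" if i: "i < d" for i
  proof -
    have "(\<Sum>j<d. of_int (M $$ (i, j)) * v $ j) = (\<Sum>j<d. map_mat complex_of_int M $$ (i, j) * v $ j)"
      using M_carrier i by (intro sum.cong) simp_all
    also have "\<dots> = (map_mat complex_of_int M *\<^sub>v v) $ i"
      using M_carrier v(1) i by (simp add: scalar_prod_def atLeast0LessThan)
    also have "\<dots> = l * v $ i" using v(1) i by (simp add: v(3))
    finally show ?thesis .
  qed
  have T_sum: "T (\<Sum>j<d. c j *\<^sub>R e j) = (\<Sum>i<d. (\<Sum>j<d. real_of_int (M $$ (i, j)) * c j) *\<^sub>R e i)" for c
  proof -
    have "T (\<Sum>j<d. c j *\<^sub>R e j) = (\<Sum>j<d. \<Sum>i<d. (real_of_int (M $$ (i, j)) * c j) *\<^sub>R e i)"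
      by (simp add: linear_sum[OF linear_T] linear_scale[OF linear_T] T_e scaleR_sum_right mult.commute)
    then show ?thesis by (subst (asm) sum.swap) (simp add: scaleR_sum_left)
  qed
  define x where "x = (\<Sum>j<d. Re (v $ j) *\<^sub>R e j)"
  define y where "y = (\<Sum>j<d. Im (v $ j) *\<^sub>R e j)"
  have re: "(\<Sum>j<d. real_of_int (M $$ (i, j)) * Re (v $ j)) = Re l * Re (v $ i) - Im l * Im (v $ i)"
    and im: "(\<Sum>j<d. real_of_int (M $$ (i, j)) * Im (v $ j)) = Im l * Re (v $ i) + Re l * Im (v $ i)"
    if "i < d" for i
    using arg_cong[OF vi[OF that], of Re] arg_cong[OF vi[OF that], of Im] by simp_all
  have "in_complex_eigenspace T l x y"
    unfolding in_complex_eigenspace_def x_def y_def T_sum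
    by (simp add: re im scaleR_left_distrib scaleR_left_diff_distrib sum.distrib sum_subtractf
        scaleR_sum_right)
  moreover have "(x, y) \<noteq> (0, 0)"
  proof
    assume xy: "(x, y) = (0, 0)"
    have zero: "c j = 0" if "(\<Sum>j<d. c j *\<^sub>R e j) = 0" "j < d" for c j
    proof -
      have inj: "inj_on e {..<d}" using basis by (simp add: ordered_basis_def)
      have "(\<Sum>b\<in>e ` {..<d}. c (inv_into {..<d} e b) *\<^sub>R b) = 0"
        using that(1) inj by (simp add: sum.reindex)
      from independentD[OF independent_basis _ _ this, of "e j"] show ?thesis
        using that(2) inj by simp
    qed
    have "v $ j = 0" if "j < d" for j
      using xy zero[OF _ that, of "\<lambda>j. Re (v $ j)"] zero[OF _ that, of "\<lambda>j. Im (v $ j)"]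
      by (simp add: x_def y_def complex_eq_iff)
    then have "v = 0\<^sub>v d" using v(1) by (intro eq_vecI) auto
    with v(2) show False by simp
  qed
  ultimately show ?thesis unfolding complex_eigenvalue_def by blast
qed

lemma lcs_eigenvalue_norm: "lcs_eigenvalue j l \<Longrightarrow> cmod l \<noteq> 1"
  using hyperbolic complex_eigenvalue_root lcs_eigenvalue_char_poly_M by blast

lemma lcs_quotient_poly:
  obtains q where "lead_coeff q = 1" "degree q = dim (U j) - dim (U (Suc j))"
    "\<And>x. x \<in> U j \<Longrightarrow> poly_map (rpoly q) T x \<in> U (Suc j)"
    "\<And>l. l \<in> roots q \<Longrightarrow> lcs_eigenvalue j l"
proof -
  obtain SU where SU: "\<forall>x\<in>SU. rational_vec x" "U (Suc j) = span SU" using rational_U by blast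
  obtain SW where SW: "\<forall>x\<in>SW. rational_vec x" "U j = span SW" using rational_U by blast
  show ?thesis
  proof (rule quotient_char_poly[OF linear_T rational_T SU(2) SW(2) U_Suc_subset _ _ T_U T_U])
    fix q
    assume "lead_coeff q = 1" "degree q = dim (U j) - dim (U (Suc j))"
      "\<And>x. x \<in> U j \<Longrightarrow> poly_map (rpoly q) T x \<in> U (Suc j)"
      "\<And>l. l \<in> roots q \<Longrightarrow> \<exists>\<phi>. linear \<phi> \<and> (\<forall>x\<in>U (Suc j). \<phi> x = 0) \<and> (\<exists>x\<in>U j. \<phi> x \<noteq> 0) \<and>
        (\<forall>x\<in>U j. \<phi> (T x) = l * \<phi> x)"
    then show ?thesis using that[of q] unfolding lcs_eigenvalue_def by blast
  qed (use SU SW in auto)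
qed

text \<open>\<open>P\<close> may be any rational polynomial annihilating \<open>T\<close> modulo
  \<open>U (Suc 0)\<close>, so that both the polynomial from \<open>abelianization_poly\<close> and
  the associated polynomial fit.\<close>

lemma prime_dvd_lcs_dim:
  assumes m: "prime m" and P: "P \<noteq> 0" "\<And>x. poly_map (rpoly P) T x \<in> U (Suc 0)"
    and irr: "\<And>g. irreducible g \<Longrightarrow> g dvd P \<Longrightarrow>
      (\<exists>j. degree g = m ^ j) \<and> 0 \<notin> roots g \<and> (\<Prod>z\<in>roots g. cmod z) = 1"
  shows "m dvd dim (U j) - dim (U (Suc j))"
proof -
  obtain q where q: "lead_coeff q = 1" "degree q = dim (U j) - dim (U (Suc j))"
    "\<And>l. l \<in> roots q \<Longrightarrow> lcs_eigenvalue j l"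
    using lcs_quotient_poly by blast
  have "m dvd degree q"
  proof (rule prime_dvd_degree[OF m _ P(1) irr])
    show "q \<noteq> 0" using q(1) by auto
    show "cmod l \<noteq> 1 \<and> (\<exists>\<alpha>. (\<forall>k<Suc j. \<alpha> k \<in> roots P) \<and> l = (\<Prod>k<Suc j. \<alpha> k))"
      if "l \<in> roots q" for l
      using lcs_eigenvalue_norm lcs_eigenvalue_prod[OF P] q(3)[OF that] by blast
  qed
  then show ?thesis by (simp add: q(2))
qed

text \<open>\<open>P\<close> itself is only known to be rational. A root of a factor
  \<open>g\<close> is also a root of \<open>char_poly M\<close>, so \<open>g\<close> divides that
  integral polynomial and has norm 1. In degree 1 the norm is the modulus of a single eigenvalue,
  against hyperbolicity.\<close>

lemma abelianization_poly:
  obtains P where "lead_coeff P = 1" "degree P = dim (U 0) - dim (U (Suc 0))"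
    "\<And>x. poly_map (rpoly P) T x \<in> U (Suc 0)"
    "\<And>g. irreducible g \<Longrightarrow> g dvd P \<Longrightarrow> 0 \<notin> roots g \<and> (\<Prod>z\<in>roots g. cmod z) = 1 \<and> degree g \<noteq> 1"
proof -
  obtain P where P: "lead_coeff P = 1" "degree P = dim (U 0) - dim (U (Suc 0))"
    "\<And>x. x \<in> U 0 \<Longrightarrow> poly_map (rpoly P) T x \<in> U (Suc 0)"
    "\<And>l. l \<in> roots P \<Longrightarrow> lcs_eigenvalue 0 l"
    using lcs_quotient_poly by blast
  show ?thesis
  proof (rule that[OF P(1,2)])
    show "poly_map (rpoly P) T x \<in> U (Suc 0)" for x by (rule P(3)) simp
    fix g assume g: "irreducible g" "g dvd P"
    have card: "card (roots g) = degree g" by (rule card_roots[OF g(1)])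
    then have "card (roots g) \<noteq> 0" using irreducible_degree_pos[OF g(1)] by simp
    then obtain z where z: "z \<in> roots g" by fastforce
    then have eig: "lcs_eigenvalue 0 z" using roots_dvd[OF g(2)] P(4) by blast
    have "g dvd map_poly of_int (char_poly M)"
      by (rule irreducible_dvd[OF g(1) z lcs_eigenvalue_char_poly_M[OF eig]])
    note norm = norm_prod_roots_int_factor[OF _ abs_coeff_0_char_poly[OF M_carrier unimodular] g(1) this]
    have lc: "lead_coeff (char_poly M) = 1"
      using degree_monic_char_poly[OF M_carrier] by simp
    have "degree g \<noteq> 1"
    proof
      assume "degree g = 1"
      then have "roots g = {z}" using card z by (metis card_1_singletonE singletonD)
      with norm(2)[OF lc] lcs_eigenvalue_norm[OF eig] show False by simp
    qed
    with norm[OF lc] show "0 \<notin> roots g \<and> (\<Prod>z\<in>roots g. cmod z) = 1 \<and> degree g \<noteq> 1" by blast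
  qed
qed

end

section \<open>Admissible degrees of irreducible factors and divisibility of the type\<close>

lemma anosov_automorphism_locale:
  assumes "lie_algebra br" "anosov_automorphism br T"
  obtains e d M where "anosov_auto br T e d M"
  using assms unfolding anosov_automorphism_def
  by (auto simp: anosov_auto_def anosov_auto_axioms_def lie_auto_def lie_auto_axioms_def lie_alg_def)

text \<open>The cofactor would be linear. This excludes degree 2 in a cubic and degree 3 in a
  quartic.\<close>

lemma codegree_irreducible_factor:
  assumes "P \<noteq> 0" "g dvd (P :: rat poly)"
    and "\<And>g. irreducible g \<Longrightarrow> g dvd P \<Longrightarrow> degree g \<noteq> 1"
  shows "degree P \<noteq> Suc (degree g)"
proof
  assume deg: "degree P = Suc (degree g)"
  obtain h where h: "P = g * h" using assms(2) by (elim dvdE)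
  have nz: "g \<noteq> 0" "h \<noteq> 0" using h assms(1) by auto
  then have h1: "degree h = 1" using h deg by (simp add: degree_mult_eq)
  then obtain k where k: "irreducible k" "k dvd h"
    using exists_irreducible_factor[of h] nz by auto
  have "degree k \<le> 1" using dvd_imp_degree_le[OF k(2) nz(2)] h1 by simp
  then have "degree k = 1" using irreducible_degree_pos[OF k(1)] by simp
  moreover have "k dvd P" using k(2) h by simp
  ultimately show False using assms(3) k(1) by blast
qed

text \<open>The assumption \<open>deg\<close> lists the degrees left over once degree 1 and codegree
  1 are excluded, so each small value of \<open>n 1\<close> becomes a finite check.\<close>

lemma (in anosov_auto) power_dvd_lcs_dim:
  assumes m: "prime m"
    and deg: "\<And>k. 0 < k \<Longrightarrow> k \<le> dim (U 0) - dim (U 1) \<Longrightarrow> k \<noteq> 1 \<Longrightarrow>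
      dim (U 0) - dim (U 1) \<noteq> Suc k \<Longrightarrow> \<exists>j. k = m ^ j"
  shows "m dvd dim (U j) - dim (U (Suc j))"
proof -
  obtain P where P: "lead_coeff P = 1" "degree P = dim (U 0) - dim (U 1)"
    "\<And>x. poly_map (rpoly P) T x \<in> U (Suc 0)"
    "\<And>g. irreducible g \<Longrightarrow> g dvd P \<Longrightarrow> 0 \<notin> roots g \<and> (\<Prod>z\<in>roots g. cmod z) = 1 \<and> degree g \<noteq> 1"
    using abelianization_poly unfolding One_nat_def by blast
  have P0: "P \<noteq> 0" using P(1) by auto
  show ?thesis
  proof (rule prime_dvd_lcs_dim[OF m P0 P(3)])
    fix g assume g: "irreducible g" "g dvd P"
    have "degree g \<le> degree P" using dvd_imp_degree_le[OF g(2) P0] .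
    moreover have "degree P \<noteq> Suc (degree g)"
      using codegree_irreducible_factor[OF P0 g(2)] P(4) by blast
    ultimately have "\<exists>j. degree g = m ^ j"
      using deg[of "degree g"] irreducible_degree_pos[OF g(1)] P(2) P(4)[OF g] by metis
    then show "(\<exists>j. degree g = m ^ j) \<and> 0 \<notin> roots g \<and> (\<Prod>z\<in>roots g. cmod z) = 1"
      using P(4)[OF g] by blast
  qed
qed

text \<open>The automorphism used is the one that comes with the associated polynomial. On the
  images of the free generators it acts by \<open>A\<close>, so \<open>char_poly A\<close>
  annihilates it modulo commutators; being irreducible, this polynomial has only factors of degree
  \<open>n ^ 1\<close>.\<close>

lemma prime_dvd_lcs_dim_associated_polynomial:
  fixes br :: "'a::real_vector \<Rightarrow> 'a \<Rightarrow> 'a" and brF :: "'f::real_vector \<Rightarrow> 'f \<Rightarrow> 'f"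
  assumes lie: "lie_algebra br" and assoc: "associated_polynomial n r brF b br p"
    and n: "prime n" and irr: "irreducible (map_poly rat_of_int p)"
  shows "n dvd dim (lower_central br j) - dim (lower_central br (Suc j))"
proof -
  obtain A :: "int mat" and fA \<phi> T where free: "free_nilpotent_lie_algebra n r brF b"
    and A: "A \<in> carrier_mat n n" "det A \<in> {1, - 1}"
    and fA: "\<forall>j<n. fA (b j) = (\<Sum>i<n. real_of_int (A $$ (i, j)) *\<^sub>R b i)"
    and \<phi>: "lie_hom brF br \<phi>" "surj \<phi>"
    and T: "anosov_automorphism br T" "\<forall>x. T (\<phi> x) = \<phi> (fA x)"
    and p: "p = char_poly A"
    using assoc unfolding associated_polynomial_def by blast
  obtain e d M where "anosov_auto br T e d M"
    using anosov_automorphism_locale[OF lie T(1)] .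
  then interpret anosov_auto br T e d M .
  have lin\<phi>: "linear \<phi>" and \<phi>_br: "\<And>x y. \<phi> (brF x y) = br (\<phi> x) (\<phi> y)"
    using \<phi>(1) by (auto simp: lie_hom_def)
  let ?P = "map_poly rat_of_int p"
  have lin: "linear (poly_map (rpoly ?P) T)" by (rule poly_map_linear[OF linear_T])
  have inv: "poly_map (rpoly ?P) T x \<in> U (Suc 0)" if "x \<in> U (Suc 0)" for x
    by (rule poly_map_mem[OF subspace_U T_U that])
  \<comment> \<open>A single letter is handled by Cayley-Hamilton for \<open>A\<close>, in a form
    that allows dependent images of the generators. A longer word is a bracket and already lies in
    the invariant subspace \<open>U (Suc 0)\<close>.\<close>
  have word: "poly_map (rpoly ?P) T (\<phi> (eval_word brF b w)) \<in> U (Suc 0)" if w: "letters w \<subseteq> {..<n}" for w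
  proof (cases w)
    case (Gen k)
    then have k: "k < n" using w by simp
    have A': "map_mat real_of_int A \<in> carrier_mat n n" using A(1) by simp
    have eq: "rpoly ?P = char_poly (map_mat real_of_int A)"
      unfolding rpoly_of_int p by (rule of_int_hom.char_poly_hom[OF A(1), symmetric])
    have "T (\<phi> (b j)) = (\<Sum>i<n. real_of_int (A $$ (i, j)) *\<^sub>R \<phi> (b i))" if "j < n" for j
      using T(2) fA that by (simp add: linear_sum[OF lin\<phi>] linear_scale[OF lin\<phi>])
    then have "poly_map (char_poly (map_mat real_of_int A)) T (\<phi> (b k)) \<in> U (Suc 0)"
      by (intro char_poly_map_mem[OF linear_T subspace_U T_U A' _ k, where e = "\<lambda>j. \<phi> (b j)"])
        (use A(1) subspace_0[OF subspace_U] in \<open>simp_all del: lower_central.simps\<close>)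
    then show ?thesis by (simp add: Gen eq del: lower_central.simps)
  next
    case (Br u v)
    show ?thesis unfolding Br eval_word.simps \<phi>_br by (intro inv br_U) simp
  qed
  have P: "poly_map (rpoly ?P) T x \<in> U (Suc 0)" for x
  proof -
    obtain y where y: "x = \<phi> y" using \<phi>(2) by (metis surjD)
    have "y \<in> Defs.eval brF b ` magma_algebra n"
      using free by (simp add: free_nilpotent_lie_algebra_def)
    then obtain c where c: "c \<in> magma_algebra n" "y = (\<Sum>w | c w \<noteq> 0. c w *\<^sub>R eval_word brF b w)"
      by (auto simp: Defs.eval_def)
    have "poly_map (rpoly ?P) T x =
        (\<Sum>w | c w \<noteq> 0. c w *\<^sub>R poly_map (rpoly ?P) T (\<phi> (eval_word brF b w)))"
      unfolding y c(2) by (simp add: linear_sum[OF lin\<phi>] linear_scale[OF lin\<phi>]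
          linear_sum[OF lin] linear_scale[OF lin])
    also have "\<dots> \<in> U (Suc 0)"
      by (intro subspace_sum subspace_scale subspace_U word)
        (use c(1) in \<open>auto simp: magma_algebra_def\<close>)
    finally show ?thesis .
  qed
  have char: "degree p = n" "lead_coeff p = 1"
    using degree_monic_char_poly[OF A(1)] by (simp_all add: p)
  have P0: "?P \<noteq> 0" using irr by auto
  show ?thesis
  proof (rule prime_dvd_lcs_dim[OF n P0 P])
    fix g assume g: "irreducible g" "g dvd ?P"
    have "?P dvd g" using irreducibleD'[OF irr g(2)] g(1) by (auto simp: irreducible_def)
    moreover have "g \<noteq> 0" using g(1) by auto
    ultimately have "degree g = degree ?P"
      using g(2) P0 by (intro antisym dvd_imp_degree_le)
    then have "degree g = n ^ 1" using char(1) by simp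
    then show "(\<exists>j. degree g = n ^ j) \<and> 0 \<notin> roots g \<and> (\<Prod>z\<in>roots g. cmod z) = 1"
      using norm_prod_roots_int_factor[OF char(2) _ g] abs_coeff_0_char_poly[OF A]
      unfolding p by blast
  qed
qed

theorem theorem1p3:
  fixes br :: "'a::real_vector \<Rightarrow> 'a \<Rightarrow> 'a" and n :: "nat \<Rightarrow> nat" and r :: nat
    and brF :: "'f::real_vector \<Rightarrow> 'f \<Rightarrow> 'f" and b :: "nat \<Rightarrow> 'f" and p1 :: "int poly"
  assumes "anosov_lie_algebra br"
    and "has_type br r n"
    and "n 1 \<ge> 3" and "r \<ge> 2"
  shows "(n 1 = 3 \<longrightarrow> (\<forall>i\<in>{2..r}. 3 dvd n i)) \<and>
         (n 1 = 4 \<longrightarrow> (\<forall>i\<in>{2..r}. even (n i))) \<and>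
         (prime (n 1) \<and> associated_polynomial (n 1) r brF b br p1 \<and>
            irreducible (map_poly rat_of_int p1) \<and> r < n 1 \<longrightarrow>
            (\<forall>i\<in>{2..r}. n 1 dvd n i))"
proof -
  have lie: "lie_algebra br" using assms(1) by (simp add: anosov_lie_algebra_def)
  obtain T where "anosov_automorphism br T" using assms(1) by (auto simp: anosov_lie_algebra_def)
  then obtain e d M where "anosov_auto br T e d M"
    using anosov_automorphism_locale[OF lie] by blast
  then interpret anosov_auto br T e d M .
  have dims: "n i = dim (U (i - 1)) - dim (U i)" if "i \<in> {1..r}" for i
    using assms(2) that by (simp add: has_type_def)
  have n1: "n 1 = dim (U 0) - dim (U 1)" using dims[of 1] assms(4) by simp
  \<comment> \<open>The type is indexed from 1, the series from 0: \<open>n i\<close> belongs to the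
    quotient with index \<open>i - 1\<close>.\<close>
  have ni: "n i = dim (U (i - 1)) - dim (U (Suc (i - 1)))" if "i \<in> {2..r}" for i
    using dims[of i] that by simp
  show ?thesis
  proof (intro conjI impI ballI)
    fix i assume "n 1 = 3" and i: "i \<in> {2..r}"
    \<comment> \<open>Degree 2 is ruled out as the codegree of a linear factor, so only 3
      remains.\<close>
    have "\<exists>j. k = 3 ^ j" if "0 < k" "k \<le> 3" "k \<noteq> 1" "3 \<noteq> Suc k" for k :: nat
    proof -
      have "k = 3 ^ 1" using that by simp
      then show ?thesis ..
    qed
    then show "3 dvd n i"
      unfolding ni[OF i] using \<open>n 1 = 3\<close> n1 by (intro power_dvd_lcs_dim) simp_all
  next
    fix i assume "n 1 = 4" and i: "i \<in> {2..r}"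
    \<comment> \<open>Without 1 and its complement 3, the possible degrees are 2 and 4.\<close>
    have "\<exists>j. k = 2 ^ j" if "0 < k" "k \<le> 4" "k \<noteq> 1" "4 \<noteq> Suc k" for k :: nat
    proof -
      have "k = 2 ^ 1 \<or> k = 2 ^ 2" using that by auto
      then show ?thesis by blast
    qed
    then show "even (n i)"
      unfolding ni[OF i] using \<open>n 1 = 4\<close> n1 by (intro power_dvd_lcs_dim) simp_all
  next
    fix i assume "prime (n 1) \<and> associated_polynomial (n 1) r brF b br p1 \<and>
      irreducible (map_poly rat_of_int p1) \<and> r < n 1" and i: "i \<in> {2..r}"
    then show "n 1 dvd n i"
      unfolding ni[OF i] using prime_dvd_lcs_dim_associated_polynomial[OF lie] by blast
  qed
qed


end
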